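(* Let $k\ge1$ be an integer and let $a\ge0$ be an even integer. Then $$\sum_{m_1,m_2\ge1}\bigl(m_1m_2(m_1+m_2)\bigr)^{2k+a}\frac{q^{2k(m_1+m_2)}}{(1-q^{m_1})^{2k}(1-q^{m_2})^{2k}(1-q^{m_1+m_2})^{2k}}\in\mathcal{QM}.$$ In particular, taking $a=2$ gives $\zeta^{2k+2}_{\mathfrak{sl}_3,q}(2k)\in\mathcal{QM}$.
   Context: $\mathcal{QM}=\mathbb C[E_2,E_4,E_6]$ is the ring of quasi-modular forms on $\mathrm{SL}(2,\mathbb Z)$ (elements need not be weight-homogeneous), where $E_{2j}=1-\frac{4j}{B_{2j}}\sum_{n\ge1}\frac{n^{2j-1}q^n}{1-q^n}$ and $B_{2j}$ are the Bernoulli numbers. The notation $\zeta^{s}_{\mathfrak{sl}_3,q}(k)$ stands (up to a nonzero constant factor coming from $\dim V(\lambda)=\frac12m_1m_2(m_1+m_2)$) for $$\sum_{m_1,m_2\ge1}\bigl(m_1m_2(m_1+m_2)\bigr)^{s}\frac{q^{k(m_1+m_2)}}{(1-q^{m_1})^{k}(1-q^{m_2})^{k}(1-q^{m_1+m_2})^{k}}.$$ *)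

theory Defs
  imports "HOL-Analysis.Analysis" "HOL-Computational_Algebra.Formal_Power_Series"
begin

text \<open>
  All $q$-series are elements of \<^typ>\<open>complex fps\<close>, with \<^term>\<open>fps_X\<close> in the role of $q$; infinite
  sums are unordered sums in the $q$-adic topology (the metric of \<^typ>\<open>complex fps\<close>).
  Apart from the Bernoulli generating function, every denominator is a unit (constant term 1).
\<close>

text \<open>
  Generating function $t/(e^t-1) = \sum_n B_n t^n/n!$. Numerator and denominator both have
  order 1, and division on \<^typ>\<open>complex fps\<close> cancels the common factor $t$.
\<close>

definition bernoulli_number :: "nat \<Rightarrow> complex" where
  "bernoulli_number n = fact n * fps_nth (fps_X / (fps_exp 1 - 1)) n"

text \<open>The argument is half the weight: \<open>eisenstein j\<close> is $E_{2j}$.\<close>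

definition eisenstein :: "nat \<Rightarrow> complex fps" where
  "eisenstein j =
     1 - fps_const (4 * of_nat j / bernoulli_number (2 * j)) *
       (\<Sum>\<^sub>\<infinity>n\<in>{1..}. of_nat n ^ (2 * j - 1) * fps_X ^ n / (1 - fps_X ^ n))"

text \<open>The ring $C[E_2,E_4,E_6]$; no homogeneity in the weight is required.\<close>

definition quasi_modular :: "complex fps set" where
  "quasi_modular =
     {F. \<exists>(A :: (nat \<times> nat \<times> nat) set) (c :: nat \<Rightarrow> nat \<Rightarrow> nat \<Rightarrow> complex). finite A \<and>
        F = (\<Sum>(i, j, l)\<in>A. fps_const (c i j l) *
               eisenstein 1 ^ i * eisenstein 2 ^ j * eisenstein 3 ^ l)}"

definition sl3_weight :: "nat \<Rightarrow> nat \<Rightarrow> nat \<Rightarrow> complex fps" where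
  "sl3_weight k m1 m2 =
     fps_X ^ (k * (m1 + m2)) /
       ((1 - fps_X ^ m1) ^ k * (1 - fps_X ^ m2) ^ k * (1 - fps_X ^ (m1 + m2)) ^ k)"

definition sl3_term :: "nat \<Rightarrow> nat \<Rightarrow> nat \<times> nat \<Rightarrow> complex fps" where
  "sl3_term s k = (\<lambda>(m1, m2). of_nat (m1 * m2 * (m1 + m2)) ^ s * sl3_weight k m1 m2)"

text \<open>
  $\dim V(\lambda)$ for $\lambda = (m_1-1)\omega_1 + (m_2-1)\omega_2$, where $m_1,m_2\ge 1$.
\<close>

definition sl3_dim :: "nat \<Rightarrow> nat \<Rightarrow> complex" where
  "sl3_dim m1 m2 = of_nat (m1 * m2 * (m1 + m2)) / 2"

text \<open>
  The $q$-zeta function, normalised by $\dim V(\lambda)$; it differs from the sum of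
  \<^const>\<open>sl3_term\<close> by the factor $2^{-s}$.
\<close>

definition sl3_qzeta :: "nat \<Rightarrow> nat \<Rightarrow> complex fps" where
  "sl3_qzeta s k =
     (\<Sum>\<^sub>\<infinity>(m1, m2)\<in>{1..} \<times> {1..}. fps_const (sl3_dim m1 m2 ^ s) * sl3_weight k m1 m2)"

end

(*
Write K(a, b) = (a b (a + b))^s with s even. Expanding the three quotients turns the sum into
the sum over a, b, x, y > 0 of K(a, b) V(min(x, y), max(x, y)) q^(a x + b y), where
V(x, y) is the sum over 0 < n < x of g(n) g(x - n) g(y - n) and g(n) = binom(n + k - 1, 2 k - 1).
As g is an odd polynomial, V agrees for x > 0 with a polynomial satisfying V(-x, -y) = V(x, y).
The min and max are removed by the substitution (a, b, x, y) -> (a, a + b, x - y, y), which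
exchanges the conditions y < x and a < b and preserves a x + b y. It yields an expression
of three times the sum through products of the series with coefficients a^t x^i, t + i odd.

These series are obtained from the G_t (coefficients a^t, t odd) by the derivation q d/dq.
The same substitution, in the form used by Skoruppa, gives the two families of relations that are
needed: one puts G_(n+7) into the ring generated by the earlier G_t, the other puts the
derivative of G_(n-1) into the ring generated by all of them. Hence no modularity is used.
*)
theory Submission
  imports Defs
begin

subsection \<open>Weighted generating functions\<close>

text \<open>The obstacle is parity. A Lambert series with coefficients \<open>a ^ t * x ^ i\<close>
  is brought into the ring only for \<open>t + i\<close> odd, while power sums over an interval mix
  both parities. Hence polynomials are kept in spans with prescribed parity of the exponents, and
  terms of the wrong parity must vanish or cancel: through positive exponents at both ends of a
  convolution, or between the two diagonals of a relation. The substitution helps because K is, for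
  even s, the s-th power of the product of the three numbers a, b, -(a + b). It is unchanged when
  they are permuted or all change sign, so that K(a, b - a) = K(a, -b). The oddness of g gives V
  matching rules under x -> x + y. These rules identify sums over different halves of the index set.
  What is left over the full index set is the difference between a polynomial and its reflection,
  and only those monomials survive that split into two factors of odd total degree.\<close>

text \<open>Meaningful only when the fibres of \<open>w\<close> on \<open>I\<close> are finite: a sum over an infinite set is \<open>0\<close>.\<close>


definition gen :: "'i set \<Rightarrow> ('i \<Rightarrow> nat) \<Rightarrow> ('i \<Rightarrow> complex) \<Rightarrow> complex fps" where
  "gen I w u = Abs_fps (\<lambda>N. \<Sum>i\<in>{i\<in>I. w i = N}. u i)"

lemma gen_nth: "fps_nth (gen I w u) N = (\<Sum>i\<in>{i\<in>I. w i = N}. u i)"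
  by (simp add: gen_def)

lemma gen_reindex:
  assumes "\<And>i. i \<in> I \<Longrightarrow> h (j i) = i" "\<And>i. i \<in> I \<Longrightarrow> j i \<in> J"
    "\<And>k. k \<in> J \<Longrightarrow> j (h k) = k" "\<And>k. k \<in> J \<Longrightarrow> h k \<in> I"
    "\<And>i. i \<in> I \<Longrightarrow> w' (j i) = w i" "\<And>i. i \<in> I \<Longrightarrow> v (j i) = u i"
  shows "gen I w u = gen J w' v"
proof (rule fps_ext)
  fix N
  show "fps_nth (gen I w u) N = fps_nth (gen J w' v) N"
    unfolding gen_nth
    by (rule sum.reindex_bij_witness[of _ h j]) (use assms in \<open>auto, metis assms(3,4,5)\<close>)
qed

lemma gen_cong:
  assumes "\<And>i. i \<in> I \<Longrightarrow> w i = w' i" "\<And>i. i \<in> I \<Longrightarrow> u i = v i"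
  shows "gen I w u = gen I w' v"
  by (rule gen_reindex[of _ "\<lambda>i. i" "\<lambda>i. i"]) (use assms in auto)

lemma gen_add: "gen I w (\<lambda>i. u i + c * v i) = gen I w u + fps_const c * gen I w v"
  by (rule fps_ext) (simp add: gen_nth sum.distrib sum_distrib_left)

lemma gen_zero: "gen I w (\<lambda>i. 0) = 0"
  by (rule fps_ext) (simp add: gen_nth)

lemma gen_deriv: "fps_X * fps_deriv (gen I w u) = gen I w (\<lambda>i. of_nat (w i) * u i)"
proof (rule fps_ext)
  fix N
  show "fps_nth (fps_X * fps_deriv (gen I w u)) N = fps_nth (gen I w (\<lambda>i. of_nat (w i) * u i)) N"
    by (cases N) (auto simp: gen_nth sum_distrib_left simp del: of_nat_Suc intro!: sum.cong)
qed

lemma gen_mult: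
  assumes fI: "\<And>N. finite {i\<in>I. w i = N}" and fJ: "\<And>N. finite {j\<in>J. w' j = N}"
  shows "gen I w u * gen J w' v = gen (I \<times> J) (\<lambda>(i, j). w i + w' j) (\<lambda>(i, j). u i * v j)"
proof (rule fps_ext)
  fix N
  define S where "S = {p \<in> I \<times> J. (case p of (i, j) \<Rightarrow> w i + w' j) = N}"
  have S_sub: "S \<subseteq> (\<Union>k\<in>{0..N}. {i\<in>I. w i = k} \<times> {j\<in>J. w' j = N - k})"
    by (auto simp: S_def)
  have fin: "finite S"
    by (rule finite_subset[OF S_sub]) (use fI fJ in auto)
  have "fps_nth (gen I w u * gen J w' v) N =
      (\<Sum>k\<in>{0..N}. \<Sum>p\<in>{i\<in>I. w i = k} \<times> {j\<in>J. w' j = N - k}. case p of (i, j) \<Rightarrow> u i * v j)"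
    by (simp add: fps_mult_nth gen_nth sum_product sum.cartesian_product)
  also have "\<dots> = (\<Sum>k\<in>{0..N}. \<Sum>p\<in>{p\<in>S. w (fst p) = k}. case p of (i, j) \<Rightarrow> u i * v j)"
    by (intro sum.cong) (auto simp: S_def)
  also have "\<dots> = (\<Sum>p\<in>S. case p of (i, j) \<Rightarrow> u i * v j)"
    by (rule sum.group) (use fin in \<open>auto simp: S_def\<close>)
  finally show "fps_nth (gen I w u * gen J w' v) N =
      fps_nth (gen (I \<times> J) (\<lambda>(i, j). w i + w' j) (\<lambda>(i, j). u i * v j)) N"
    by (simp add: gen_nth S_def)
qed

text \<open>Pushforward along a weight-preserving map. It collects index tuples that share an
  exponent pattern: the pairs with \<open>a + b = N\<close> on the diagonal \<open>x = y\<close>,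
  and the values \<open>0 < n < min x y\<close> in the expansion of the three quotients.\<close>

lemma gen_collapse:
  assumes fI: "\<And>N. finite {i\<in>I. w i = N}" and fJ: "\<And>N. finite {j\<in>J. w' j = N}"
    and f: "\<And>i. i \<in> I \<Longrightarrow> f i \<in> J" and w: "\<And>i. i \<in> I \<Longrightarrow> w' (f i) = w i"
  shows "gen I w u = gen J w' (\<lambda>j. \<Sum>i\<in>{i\<in>I. f i = j}. u i)"
proof (rule fps_ext)
  fix N
  have "(\<Sum>j\<in>{j\<in>J. w' j = N}. \<Sum>i\<in>{i\<in>I. f i = j}. u i) =
      (\<Sum>j\<in>{j\<in>J. w' j = N}. \<Sum>i\<in>{i \<in> {i\<in>I. w i = N}. f i = j}. u i)"
    by (intro sum.cong) (auto simp: w)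
  also have "\<dots> = (\<Sum>i\<in>{i\<in>I. w i = N}. u i)"
    by (rule sum.group) (use fI fJ f w in auto)
  finally show "fps_nth (gen I w u) N = fps_nth (gen J w' (\<lambda>j. \<Sum>i\<in>{i\<in>I. f i = j}. u i)) N"
    by (simp add: gen_nth)
qed

text \<open>Convergence in the q-adic topology means that each coefficient is eventually constant
  along finite subsets. Once such a subset contains the first components of the finite fibre over
  \<open>N\<close>, the coefficient of index \<open>N\<close> no longer changes.\<close>

lemma has_sum_gen:
  fixes u :: "'m \<Rightarrow> 'i \<Rightarrow> complex"
  assumes fin: "\<And>N. finite {p \<in> Sigma A I. (case p of (m, i) \<Rightarrow> w m i) = N}"
  shows "((\<lambda>m. gen (I m) (w m) (u m)) has_sum
    gen (Sigma A I) (\<lambda>(m, i). w m i) (\<lambda>(m, i). u m i)) A"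
  unfolding has_sum_def
proof (rule tendsto_fpsI)
  fix N
  define S where "S = {p \<in> Sigma A I. (case p of (m, i) \<Rightarrow> w m i) = N}"
  have finS: "finite S" using fin by (simp add: S_def)
  show "\<forall>\<^sub>F F in finite_subsets_at_top A. fps_nth (\<Sum>m\<in>F. gen (I m) (w m) (u m)) N =
      fps_nth (gen (Sigma A I) (\<lambda>(m, i). w m i) (\<lambda>(m, i). u m i)) N"
    unfolding eventually_finite_subsets_at_top
  proof (rule exI[of _ "fst ` S"], intro conjI allI impI)
    show "finite (fst ` S)" using finS by simp
    show "fst ` S \<subseteq> A" by (auto simp: S_def)
    fix F assume F: "finite F \<and> fst ` S \<subseteq> F \<and> F \<subseteq> A"
    have fm: "finite {i\<in>I m. w m i = N}" if "m \<in> F" for m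
      by (rule finite_subset[of _ "snd ` S"]) (use that F finS in \<open>force simp: S_def\<close>)+
    have "(\<Sum>m\<in>F. \<Sum>i\<in>{i\<in>I m. w m i = N}. u m i) =
        (\<Sum>p\<in>Sigma F (\<lambda>m. {i\<in>I m. w m i = N}). case p of (m, i) \<Rightarrow> u m i)"
      using F fm by (simp add: sum.Sigma)
    also have "Sigma F (\<lambda>m. {i\<in>I m. w m i = N}) = S"
      using F by (force simp: S_def)
    finally show "fps_nth (\<Sum>m\<in>F. gen (I m) (w m) (u m)) N =
        fps_nth (gen (Sigma A I) (\<lambda>(m, i). w m i) (\<lambda>(m, i). u m i)) N"
      by (simp add: fps_sum_nth gen_nth S_def)
  qed
qed

section \<open>Expansion of negative powers of \<open>1 - fps_X ^ m\<close>\<close>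

lemma gen_multiples_nth:
  assumes "m > 0"
  shows "fps_nth (gen {r..} (\<lambda>u. m * u) c) N = (if m dvd N \<and> r \<le> N div m then c (N div m) else 0)"
proof -
  have "{u \<in> {r..}. m * u = N} = (if m dvd N \<and> r \<le> N div m then {N div m} else {})"
    using assms by auto
  then show ?thesis by (simp add: gen_nth)
qed

lemma gen_multiples_mult:
  assumes "m > 0"
  shows "gen {r..} (\<lambda>u. m * u) c * (1 - fps_X ^ m) =
    gen {r..} (\<lambda>u. m * u) (\<lambda>u. c u - (if r < u then c (u - 1) else 0))"
proof (rule fps_ext)
  fix N
  let ?G = "gen {r..} (\<lambda>u. m * u) c"
  have eq: "fps_nth (?G * (1 - fps_X ^ m)) N =
      fps_nth ?G N - (if N < m then 0 else fps_nth ?G (N - m))"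
    by (simp add: right_diff_distrib fps_X_power_mult_right_nth)
  show "fps_nth (?G * (1 - fps_X ^ m)) N =
      fps_nth (gen {r..} (\<lambda>u. m * u) (\<lambda>u. c u - (if r < u then c (u - 1) else 0))) N"
  proof (cases "m dvd N")
    case False
    then have "\<not> m dvd N - m" if "\<not> N < m" using that dvd_diffD[of m N m] by auto
    with False show ?thesis unfolding eq gen_multiples_nth[OF assms] by simp
  next
    case True
    then obtain q where q: "N = m * q" by blast
    show ?thesis
    proof (cases q)
      case 0
      then show ?thesis unfolding eq gen_multiples_nth[OF assms] using assms q by simp
    next
      case (Suc q')
      then have "N - m = m * q'" using q by simp
      then show ?thesis unfolding eq gen_multiples_nth[OF assms] using assms q Suc by auto
    qed
  qed
qed

text \<open>Checked by multiplying back: each factor \<open>1 - fps_X ^ m\<close> takes a backward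
  difference in \<open>u\<close>, which by Pascal's rule lowers the binomial coefficient by one
  step, until only the term \<open>u = r\<close> remains.\<close>

lemma fps_X_power_divide_eq_gen:
  assumes "m > 0"
  shows "fps_X ^ (r * m) / (1 - fps_X ^ m) ^ Suc n =
    gen {r..} (\<lambda>u. m * u) (\<lambda>u. of_nat ((u - r + n) choose n))"
proof -
  have "gen {r..} (\<lambda>u. m * u) (\<lambda>u. of_nat ((u - r + n) choose n)) * (1 - fps_X ^ m) ^ Suc n =
      (fps_X :: complex fps) ^ (r * m)"
  proof (induction n)
    case 0
    have "gen {r..} (\<lambda>u. m * u) (\<lambda>u. if u = r then 1 else 0) = fps_X ^ (r * m)"
      by (rule fps_ext) (use assms in \<open>auto simp: gen_multiples_nth fps_X_power_nth\<close>)
    moreover have "gen {r..} (\<lambda>u. m * u) (\<lambda>u. 1 - (if r < u then 1 else 0)) =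
        gen {r..} (\<lambda>u. m * u) (\<lambda>u. if u = r then 1 else 0)"
      by (rule gen_cong) auto
    ultimately show ?case by (simp add: gen_multiples_mult[OF assms])
  next
    case (Suc n)
    have "gen {r..} (\<lambda>u. m * u) (\<lambda>u. of_nat ((u - r + Suc n) choose Suc n)) * (1 - fps_X ^ m) =
        gen {r..} (\<lambda>u. m * u) (\<lambda>u. of_nat ((u - r + n) choose n))"
      unfolding gen_multiples_mult[OF assms]
    proof (rule gen_cong)
      fix u assume "u \<in> {r..}"
      then obtain d where d: "u = r + d" using le_Suc_ex by auto
      show "of_nat ((u - r + Suc n) choose Suc n) -
          (if r < u then of_nat ((u - 1 - r + Suc n) choose Suc n) else 0) =
          (of_nat ((u - r + n) choose n) :: complex)"
        by (cases d) (simp_all add: d)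
    qed simp
    with Suc show ?case by (simp add: mult.assoc[symmetric] del: binomial_Suc_Suc)
  qed
  moreover have "(1 - fps_X ^ m :: complex fps) ^ Suc n \<noteq> 0"
  proof
    assume "(1 - fps_X ^ m :: complex fps) ^ Suc n = 0"
    then have "(1 - fps_X ^ m :: complex fps) = 0" using power_eq_0_iff by blast
    then have "fps_nth (1 - fps_X ^ m :: complex fps) 0 = 0" by (simp only: fps_zero_nth)
    with assms show False by simp
  qed
  ultimately show ?thesis by (metis nonzero_mult_div_cancel_right)
qed


subsection \<open>Lambert series in one and two pairs of variables\<close>

text \<open>The indices are integers, although positive on the range of summation, because
  coefficient functions are later evaluated at \<open>- b\<close>, \<open>b - a\<close> and
  \<open>- x\<close>.\<close>

definition lam1 :: "(int \<Rightarrow> int \<Rightarrow> complex) \<Rightarrow> complex fps" where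
  "lam1 \<phi> = gen {(a, x). 0 < a \<and> 0 < x} (\<lambda>(a, x). nat (a * x)) (\<lambda>(a, x). \<phi> a x)"

definition lam2 :: "(int \<Rightarrow> int \<Rightarrow> int \<Rightarrow> int \<Rightarrow> complex) \<Rightarrow> complex fps" where
  "lam2 \<phi> = gen {(a, b, x, y). 0 < a \<and> 0 < b \<and> 0 < x \<and> 0 < y}
     (\<lambda>(a, b, x, y). nat (a * x + b * y)) (\<lambda>(a, b, x, y). \<phi> a b x y)"

lemma pos_le_mult_int: "0 < a \<Longrightarrow> 0 < x \<Longrightarrow> a \<le> a * x \<and> x \<le> a * x" for a x :: int
  by (simp add: mult_le_cancel_left1 mult_le_cancel_right1)

lemma finite_lam1_fibre: "finite {p \<in> {(a, x). 0 < a \<and> 0 < x}. (case p of (a, x) \<Rightarrow> nat (a * x)) = N}"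
proof (rule finite_subset)
  show "{p \<in> {(a, x). 0 < a \<and> 0 < x}. (case p of (a, x) \<Rightarrow> nat (a * x)) = N} \<subseteq> {0..int N} \<times> {0..int N}"
    using pos_le_mult_int by fastforce
qed simp

lemma finite_lam2_fibre:
  "finite {p \<in> {(a, b, x, y). 0 < a \<and> 0 < b \<and> 0 < x \<and> 0 < y}.
     (case p of (a, b, x, y) \<Rightarrow> nat (a * x + b * y)) = N}"
proof (rule finite_subset)
  show "{p \<in> {(a, b, x, y). 0 < a \<and> 0 < b \<and> 0 < x \<and> 0 < y}.
     (case p of (a, b, x, y) \<Rightarrow> nat (a * x + b * y)) = N} \<subseteq>
     {0..int N} \<times> {0..int N} \<times> {0..int N} \<times> {0..int N}"
  proof
    fix p :: "int \<times> int \<times> int \<times> int"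
    assume p: "p \<in> {p \<in> {(a, b, x, y). 0 < a \<and> 0 < b \<and> 0 < x \<and> 0 < y}.
      (case p of (a, b, x, y) \<Rightarrow> nat (a * x + b * y)) = N}"
    obtain a b x y where eq: "p = (a, b, x, y)" by (cases p)
    with p have *: "0 < a" "0 < b" "0 < x" "0 < y" "N = nat (a * x + b * y)" by auto
    then have "a * x + b * y = int N" by simp
    moreover have "0 < a * x" "0 < b * y" using * by auto
    ultimately have "a \<le> int N" "b \<le> int N" "x \<le> int N" "y \<le> int N"
      using pos_le_mult_int[OF *(1,3)] pos_le_mult_int[OF *(2,4)] by linarith+
    with * eq show "p \<in> {0..int N} \<times> {0..int N} \<times> {0..int N} \<times> {0..int N}"
      by simp
  qed
qed simp

lemma gen_if:
  assumes "\<And>N. finite {i\<in>I. w i = N}"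
  shows "gen I w (\<lambda>i. if P i then u i else 0) = gen {i\<in>I. P i} w u"
proof (rule fps_ext)
  fix N
  have "(\<Sum>i\<in>{i\<in>I. w i = N}. if P i then u i else 0) = (\<Sum>i\<in>{i \<in> {i\<in>I. w i = N}. P i}. u i)"
    by (rule sum.inter_filter[symmetric]) (rule assms)
  also have "{i \<in> {i\<in>I. w i = N}. P i} = {i \<in> {i\<in>I. P i}. w i = N}" by auto
  finally show "fps_nth (gen I w (\<lambda>i. if P i then u i else 0)) N = fps_nth (gen {i\<in>I. P i} w u) N"
    by (simp add: gen_nth)
qed

lemma lam1_add: "lam1 (\<lambda>a x. \<phi> a x + c * \<psi> a x) = lam1 \<phi> + fps_const c * lam1 \<psi>"
  using gen_add[of "{(a, x). 0 < a \<and> 0 < x}" "\<lambda>(a, x). nat (a * x)" "\<lambda>(a, x). \<phi> a x" c "\<lambda>(a, x). \<psi> a x"]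
  by (simp add: lam1_def case_prod_unfold)

lemma lam2_add: "lam2 (\<lambda>a b x y. \<phi> a b x y + c * \<psi> a b x y) = lam2 \<phi> + fps_const c * lam2 \<psi>"
  using gen_add[of "{(a, b, x, y). 0 < a \<and> 0 < b \<and> 0 < x \<and> 0 < y}"
      "\<lambda>(a, b, x, y). nat (a * x + b * y)" "\<lambda>(a, b, x, y). \<phi> a b x y" c "\<lambda>(a, b, x, y). \<psi> a b x y"]
  by (simp add: lam2_def case_prod_unfold)

lemma lam1_zero [simp]: "lam1 (\<lambda>a x. 0) = 0"
  by (simp add: lam1_def case_prod_unfold gen_zero)

lemma lam2_zero [simp]: "lam2 (\<lambda>a b x y. 0) = 0"
  by (simp add: lam2_def case_prod_unfold gen_zero)

lemma lam1_cong:
  "(\<And>a x. 0 < a \<Longrightarrow> 0 < x \<Longrightarrow> \<phi> a x = \<psi> a x) \<Longrightarrow> lam1 \<phi> = lam1 \<psi>"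
  unfolding lam1_def by (rule gen_cong) auto

lemma lam2_cong:
  "(\<And>a b x y. 0 < a \<Longrightarrow> 0 < b \<Longrightarrow> 0 < x \<Longrightarrow> 0 < y \<Longrightarrow> \<phi> a b x y = \<psi> a b x y) \<Longrightarrow> lam2 \<phi> = lam2 \<psi>"
  unfolding lam2_def by (rule gen_cong) auto

lemma lam1_scale: "lam1 (\<lambda>a x. c * \<psi> a x) = fps_const c * lam1 \<psi>"
  using lam1_add[of "\<lambda>a x. 0" c \<psi>] by simp

lemma lam2_scale: "lam2 (\<lambda>a b x y. c * \<psi> a b x y) = fps_const c * lam2 \<psi>"
  using lam2_add[of "\<lambda>a b x y. 0" c \<psi>] by simp

lemma lam2_plus: "lam2 (\<lambda>a b x y. \<phi> a b x y + \<psi> a b x y) = lam2 \<phi> + lam2 \<psi>"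
  using lam2_add[of \<phi> 1 \<psi>] by simp

lemma lam2_minus: "lam2 (\<lambda>a b x y. \<phi> a b x y - \<psi> a b x y) = lam2 \<phi> - lam2 \<psi>"
  using lam2_add[of \<phi> "-1" \<psi>] by (simp flip: fps_const_neg)

lemma lam1_swap: "lam1 \<phi> = lam1 (\<lambda>a x. \<phi> x a)"
  unfolding lam1_def
  by (rule gen_reindex[of _ "\<lambda>(a, x). (x, a)" "\<lambda>(a, x). (x, a)"]) (auto simp: mult.commute)

lemma lam2_swap: "lam2 \<phi> = lam2 (\<lambda>a b x y. \<phi> b a y x)"
  unfolding lam2_def
  by (rule gen_reindex[of _ "\<lambda>(a, b, x, y). (b, a, y, x)" "\<lambda>(a, b, x, y). (b, a, y, x)"])
     (auto simp: add.commute)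

lemma lam2_dual: "lam2 \<phi> = lam2 (\<lambda>a b x y. \<phi> x y a b)"
  unfolding lam2_def
  by (rule gen_reindex[of _ "\<lambda>(a, b, x, y). (x, y, a, b)" "\<lambda>(a, b, x, y). (x, y, a, b)"])
     (auto simp: mult.commute)

lemma lam1_deriv: "fps_X * fps_deriv (lam1 \<phi>) = lam1 (\<lambda>a x. of_int (a * x) * \<phi> a x)"
proof -
  have "of_nat (nat (a * x)) = (of_int (a * x) :: complex)" if "0 < a" "0 < x" for a x
  proof -
    have "of_nat (nat (a * x)) = (of_int (int (nat (a * x))) :: complex)" by (rule of_int_of_nat_eq[symmetric])
    then show ?thesis using that by simp
  qed
  then show ?thesis
    unfolding lam1_def gen_deriv by (intro gen_cong) auto
qed

lemma lam2_product: "lam2 (\<lambda>a b x y. \<phi> a x * \<psi> b y) = lam1 \<phi> * lam1 \<psi>"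
  unfolding lam1_def lam2_def gen_mult[OF finite_lam1_fibre finite_lam1_fibre]
  by (rule gen_reindex[of _ "\<lambda>((a, x), (b, y)). (a, b, x, y)" "\<lambda>(a, b, x, y). ((a, x), (b, y))"])
     (auto simp: nat_add_distrib)

text \<open>Both sides are sums over \<open>a x + b y = a (x - y) + (a + b) y\<close> with \<open>x > y\<close>.\<close>

lemma lam2_shear:
  "lam2 (\<lambda>a b x y. if y < x then \<phi> a b x y else 0) =
   lam2 (\<lambda>a b x y. if a < b then \<phi> a (b - a) (x + y) y else 0)"
proof -
  let ?I = "{(a, b, x, y). 0 < a \<and> 0 < b \<and> 0 < x \<and> 0 < y} :: (int \<times> int \<times> int \<times> int) set"
  let ?w = "\<lambda>(a, b, x, y). nat (a * x + b * y) :: nat"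
  have "gen ?I ?w (\<lambda>p. if (case p of (a, b, x, y) \<Rightarrow> y < x) then (case p of (a, b, x, y) \<Rightarrow> \<phi> a b x y) else 0) =
      gen ?I ?w (\<lambda>p. if (case p of (a, b, x, y) \<Rightarrow> a < b) then (case p of (a, b, x, y) \<Rightarrow> \<phi> a (b - a) (x + y) y) else 0)"
    unfolding gen_if[OF finite_lam2_fibre]
    by (rule gen_reindex[of _ "\<lambda>(a, b, x, y). (a, b - a, x + y, y)" "\<lambda>(a, b, x, y). (a, a + b, x - y, y)"])
       (auto simp: algebra_simps)
  moreover have "lam2 (\<lambda>a b x y. if y < x then \<phi> a b x y else 0) =
      gen ?I ?w (\<lambda>p. if (case p of (a, b, x, y) \<Rightarrow> y < x) then (case p of (a, b, x, y) \<Rightarrow> \<phi> a b x y) else 0)"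
    unfolding lam2_def by (rule gen_cong) auto
  moreover have "lam2 (\<lambda>a b x y. if a < b then \<phi> a (b - a) (x + y) y else 0) =
      gen ?I ?w (\<lambda>p. if (case p of (a, b, x, y) \<Rightarrow> a < b) then (case p of (a, b, x, y) \<Rightarrow> \<phi> a (b - a) (x + y) y) else 0)"
    unfolding lam2_def by (rule gen_cong) auto
  ultimately show ?thesis by simp
qed

text \<open>On \<open>x = y\<close> the exponent is \<open>(a + b) * x\<close>, so the sum depends
  on \<open>a\<close> and \<open>b\<close> through their convolution over \<open>a + b = N\<close>.
  This is where power sums enter.\<close>

lemma lam2_diagonal:
  "lam2 (\<lambda>a b x y. if x = y then \<phi> a b x else 0) = lam1 (\<lambda>N x. \<Sum>a\<in>{0<..<N}. \<phi> a (N - a) x)"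
proof -
  let ?I = "{(a, b, x, y). 0 < a \<and> 0 < b \<and> 0 < x \<and> 0 < y} :: (int \<times> int \<times> int \<times> int) set"
  let ?J = "{p\<in>?I. case p of (a, b, x, y) \<Rightarrow> x = y}"
  let ?w = "\<lambda>(a, b, x, y). nat (a * x + b * y) :: nat"
  let ?f = "\<lambda>(a, b, x, y). (a + b, x) :: int \<times> int"
  let ?u = "\<lambda>(a, b, x, y). \<phi> a b x"
  have "lam2 (\<lambda>a b x y. if x = y then \<phi> a b x else 0) =
      gen ?I ?w (\<lambda>p. if (case p of (a, b, x, y) \<Rightarrow> x = y) then ?u p else 0)"
    unfolding lam2_def by (rule gen_cong) auto
  also have "\<dots> = gen ?J ?w ?u"
    by (rule gen_if[OF finite_lam2_fibre])
  also have "\<dots> = gen {(a, x). 0 < a \<and> 0 < x} (\<lambda>(a, x). nat (a * x)) (\<lambda>j. \<Sum>i\<in>{i\<in>?J. ?f i = j}. ?u i)"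
  proof (rule gen_collapse)
    show "finite {i \<in> ?J. ?w i = N}" for N
      by (rule finite_subset[OF _ finite_lam2_fibre[of N]]) auto
  qed (use finite_lam1_fibre in \<open>auto simp: algebra_simps\<close>)
  also have "\<dots> = lam1 (\<lambda>N x. \<Sum>a\<in>{0<..<N}. \<phi> a (N - a) x)"
    unfolding lam1_def
  proof (rule gen_cong)
    fix j :: "int \<times> int"
    assume "j \<in> {(a, x). 0 < a \<and> 0 < x}"
    then obtain N x where j: "j = (N, x)" "0 < N" "0 < x" by auto
    have "(\<Sum>i\<in>{i\<in>?J. ?f i = j}. ?u i) = (\<Sum>a\<in>{0<..<N}. \<phi> a (N - a) x)"
      by (rule sum.reindex_bij_witness[of _ "\<lambda>a. (a, N - a, x, x)" "\<lambda>(a, b, x, y). a"])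
         (use j in auto)
    with j show "(\<Sum>i\<in>{i\<in>?J. ?f i = j}. ?u i) = (case j of (N, x) \<Rightarrow> \<Sum>a\<in>{0<..<N}. \<phi> a (N - a) x)"
      by simp
  qed simp
  finally show ?thesis .
qed

subsection \<open>Polynomial functions and the parity of power sums\<close>

text \<open>The complex linear span, built by adding one scaled generator at a time: rule induction
  then reduces any claim that is linear in the function to the generators.\<close>

inductive_set cspan :: "('a \<Rightarrow> complex) set \<Rightarrow> ('a \<Rightarrow> complex) set" for B where
  zero: "(\<lambda>_. 0) \<in> cspan B"
| add: "f \<in> cspan B \<Longrightarrow> g \<in> B \<Longrightarrow> (\<lambda>x. f x + c * g x) \<in> cspan B"

lemma cspan_add_scaled: "g \<in> cspan B \<Longrightarrow> f \<in> cspan B \<Longrightarrow> (\<lambda>x. f x + c * g x) \<in> cspan B"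
proof (induction rule: cspan.induct)
  case (add h g d)
  have "(\<lambda>x. (f x + c * h x) + (c * d) * g x) \<in> cspan B"
    by (rule cspan.add[OF add.IH[OF add.prems] add.hyps(2)])
  then show ?case by (simp add: algebra_simps)
qed simp

lemma cspan_plus: "f \<in> cspan B \<Longrightarrow> g \<in> cspan B \<Longrightarrow> (\<lambda>x. f x + g x) \<in> cspan B"
  using cspan_add_scaled[of g B f 1] by simp

lemma cspan_scale: "g \<in> cspan B \<Longrightarrow> (\<lambda>x. c * g x) \<in> cspan B"
  using cspan_add_scaled[OF _ cspan.zero, of g B c] by simp

lemma cspan_base: "g \<in> B \<Longrightarrow> g \<in> cspan B"
  using cspan.add[OF cspan.zero, of g B 1] by simp

lemma cspan_sum: "(\<And>i. i \<in> A \<Longrightarrow> f i \<in> cspan B) \<Longrightarrow> (\<lambda>x. \<Sum>i\<in>A. f i x) \<in> cspan B"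
  by (induction A rule: infinite_finite_induct) (auto intro: cspan.zero cspan_plus)

text \<open>The maps \<open>p\<close> and \<open>q\<close> let one statement serve pointwise
  products (both the identity) and tensor products (the two projections).\<close>

lemma cspan_bilinear:
  assumes "f \<in> cspan B" "g \<in> cspan C" "\<And>u v. u \<in> B \<Longrightarrow> v \<in> C \<Longrightarrow> (\<lambda>x. u (p x) * v (q x)) \<in> cspan E"
  shows "(\<lambda>x. f (p x) * g (q x)) \<in> cspan E"
  using assms(1)
proof (induction rule: cspan.induct)
  case zero
  show ?case by (simp add: cspan.zero)
next
  case (add f u c)
  have "(\<lambda>x. u (p x) * g (q x)) \<in> cspan E"
    using assms(2)
  proof (induction rule: cspan.induct)
    case zero
    show ?case by (simp add: cspan.zero)
  next
    case (add g v d)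
    have "(\<lambda>x. u (p x) * g (q x) + d * (u (p x) * v (q x))) \<in> cspan E"
      by (rule cspan_add_scaled[OF assms(3)]) (use add \<open>u \<in> B\<close> in auto)
    then show ?case by (simp add: algebra_simps)
  qed
  from cspan_add_scaled[OF this add.IH] show ?case by (simp add: algebra_simps)
qed

text \<open>The predicate on exponents records a degree bound and a parity at the same time. Both
  are needed: the bound for recursions, the parity for membership in the ring.\<close>

definition pspan :: "(nat \<Rightarrow> bool) \<Rightarrow> (int \<Rightarrow> complex) set" where
  "pspan P = cspan {(\<lambda>x. of_int x ^ i) | i. P i}"

definition bspan :: "(nat \<Rightarrow> nat \<Rightarrow> bool) \<Rightarrow> (int \<times> int \<Rightarrow> complex) set" where
  "bspan P = cspan {(\<lambda>p. of_int (fst p) ^ i * of_int (snd p) ^ j) | i j. P i j}"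

lemma pspan_power: "P i \<Longrightarrow> (\<lambda>x. of_int x ^ i) \<in> pspan P"
  unfolding pspan_def by (rule cspan_base) auto

lemma bspan_power: "P i j \<Longrightarrow> (\<lambda>p. of_int (fst p) ^ i * of_int (snd p) ^ j) \<in> bspan P"
  unfolding bspan_def by (rule cspan_base) auto

lemma pspan_mono:
  assumes "f \<in> pspan P" "\<And>i. P i \<Longrightarrow> Q i" shows "f \<in> pspan Q"
  using assms(1) unfolding pspan_def
  by (induction rule: cspan.induct) (auto intro!: cspan.intros intro: assms(2))

lemma pspan_mult:
  assumes "f \<in> pspan P" "g \<in> pspan Q" "\<And>i j. P i \<Longrightarrow> Q j \<Longrightarrow> R (i + j)"
  shows "(\<lambda>x. f x * g x) \<in> pspan R"
  using assms(1,2) unfolding pspan_def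
  by (rule cspan_bilinear) (auto simp flip: power_add intro!: cspan_base intro: assms(3))

lemma bspan_mult:
  assumes "f \<in> bspan P" "g \<in> bspan Q" "\<And>i j k l. P i j \<Longrightarrow> Q k l \<Longrightarrow> R (i + k) (j + l)"
  shows "(\<lambda>x. f x * g x) \<in> bspan R"
  using assms(1,2) unfolding bspan_def
proof (rule cspan_bilinear)
  fix u v :: "int \<times> int \<Rightarrow> complex"
  assume "u \<in> {(\<lambda>p. of_int (fst p) ^ i * of_int (snd p) ^ j) | i j. P i j}"
    "v \<in> {(\<lambda>p. of_int (fst p) ^ i * of_int (snd p) ^ j) | i j. Q i j}"
  then obtain i j k l where "P i j" "Q k l"
    "u = (\<lambda>p. of_int (fst p) ^ i * of_int (snd p) ^ j)" "v = (\<lambda>p. of_int (fst p) ^ k * of_int (snd p) ^ l)"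
    by auto
  then have "(\<lambda>p. u p * v p) = (\<lambda>p. of_int (fst p) ^ (i + k) * of_int (snd p) ^ (j + l))"
    by (simp add: power_add fun_eq_iff)
  then show "(\<lambda>p. u p * v p) \<in> cspan {(\<lambda>p. of_int (fst p) ^ i * of_int (snd p) ^ j) | i j. R i j}"
    using assms(3)[OF \<open>P i j\<close> \<open>Q k l\<close>] by (auto intro: cspan_base)
qed

lemma bspan_tensor:
  assumes "f \<in> pspan P" "g \<in> pspan Q" "\<And>i j. P i \<Longrightarrow> Q j \<Longrightarrow> R i j"
  shows "(\<lambda>p. f (fst p) * g (snd p)) \<in> bspan R"
  using assms(1,2) unfolding pspan_def bspan_def
  by (rule cspan_bilinear) (use assms(3) in \<open>auto intro!: cspan_base\<close>)

text \<open>
  In terms of \<open>y = x + 1/2\<close>, differences and averages of \<open>x ^ m\<close> and \<open>(x + 1) ^ m\<close> have a parity.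
\<close>

lemma power_difference_sum:
  "\<exists>d. (\<forall>i. even (i + m) \<or> d i = 0) \<and>
    (\<forall>y :: complex. (y + 1/2) ^ Suc m - (y - 1/2) ^ Suc m = of_nat (Suc m) * y ^ m + (\<Sum>i<m. d i * y ^ i))"
proof -
  \<comment> \<open>The factor \<open>(1/2) ^ j - (- 1/2) ^ j\<close> with
    \<open>j = Suc m - i\<close> vanishes for even \<open>j\<close>, which covers the wrong parities
    and also the top term \<open>i = Suc m\<close>.\<close>
  define d :: "nat \<Rightarrow> complex" where
    "d i = of_nat (Suc m choose i) * ((1/2) ^ (Suc m - i) - (- 1/2) ^ (Suc m - i))" for i
  have "even (i + m) \<or> d i = 0" for i
  proof (cases "even (i + m) \<or> m < i")
    case True
    then show ?thesis by (cases "i = Suc m") (auto simp: d_def)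
  next
    case False
    then have "even (Suc m - i)" by simp
    then show ?thesis by (simp add: d_def)
  qed
  moreover have "(y + 1/2) ^ Suc m - (y - 1/2) ^ Suc m = of_nat (Suc m) * y ^ m + (\<Sum>i<m. d i * y ^ i)" for y
  proof -
    have "(y + 1/2) ^ Suc m - (y + (- 1/2)) ^ Suc m = (\<Sum>i\<le>Suc m. d i * y ^ i)"
      unfolding binomial_ring d_def sum_subtractf[symmetric]
      by (intro sum.cong) (auto simp: algebra_simps)
    also have "{..Suc m} = insert (Suc m) (insert m {..<m})" by auto
    finally show ?thesis by (simp add: d_def)
  qed
  ultimately show ?thesis by (intro exI[of _ d] conjI allI)
qed

lemma power_average_sum:
  "\<exists>d. (\<forall>i. even (i + m) \<or> d i = 0) \<and>
    (\<forall>y :: complex. ((y + 1/2) ^ m + (y - 1/2) ^ m) / 2 = y ^ m + (\<Sum>i<m. d i * y ^ i))"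
proof -
  define d :: "nat \<Rightarrow> complex" where
    "d i = of_nat (m choose i) * ((1/2) ^ (m - i) + (- 1/2) ^ (m - i)) / 2" for i
  have "even (i + m) \<or> d i = 0" for i
  proof (cases "even (i + m) \<or> m < i")
    case True
    then show ?thesis by (auto simp: d_def)
  next
    case False
    then have "odd (m - i)" by simp
    then show ?thesis by (simp add: d_def)
  qed
  moreover have "((y + 1/2) ^ m + (y - 1/2) ^ m) / 2 = y ^ m + (\<Sum>i<m. d i * y ^ i)" for y
  proof -
    have "((y + 1/2) ^ m + (y + (- 1/2)) ^ m) / 2 = (\<Sum>i\<le>m. d i * y ^ i)"
      unfolding binomial_ring d_def sum.distrib[symmetric] sum_divide_distrib
      by (intro sum.cong) (auto simp: algebra_simps)
    also have "{..m} = insert m {..<m}" by auto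
    finally show ?thesis by (simp add: d_def)
  qed
  ultimately show ?thesis by (intro exI[of _ d] conjI allI)
qed

text \<open>Up to a constant the antidifference is B(x + 1/2) / (m + 1) for the Bernoulli polynomial
  B of degree m + 1, which has the parity of m + 1. Here it is built by recursion: the difference of
  \<open>x ^ Suc m\<close> is \<open>Suc m\<close> times the wanted power plus lower powers of
  \<open>x + 1/2\<close> of the same parity, whose antidifferences are subtracted.\<close>

lemma shifted_power_antidifference:
  "\<exists>f\<in>pspan (\<lambda>i. 0 < i \<and> i < m \<and> odd (i + m)). \<forall>x.
     (of_int (x + 1) ^ Suc m - of_int x ^ Suc m) / of_nat (Suc m) + (f (x + 1) - f x) = (of_int x + 1/2) ^ m"
proof (induction m rule: less_induct)
  case (less m)
  then have "\<forall>i. \<exists>f. i < m \<longrightarrow> f \<in> pspan (\<lambda>j. 0 < j \<and> j < i \<and> odd (j + i)) \<and> (\<forall>x.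
      (of_int (x + 1) ^ Suc i - of_int x ^ Suc i) / of_nat (Suc i) + (f (x + 1) - f x) = (of_int x + 1/2) ^ i)"
    by blast
  from choice[OF this] obtain f where f: "\<And>i. i < m \<Longrightarrow> f i \<in> pspan (\<lambda>j. 0 < j \<and> j < i \<and> odd (j + i))"
    and fd: "\<And>i x. i < m \<Longrightarrow>
      (of_int (x + 1) ^ Suc i - of_int x ^ Suc i) / of_nat (Suc i) + (f i (x + 1) - f i x) = (of_int x + 1/2) ^ i"
    by blast
  obtain d where d: "\<And>i. even (i + m) \<or> d i = 0"
    and dy: "\<And>y :: complex. (y + 1/2) ^ Suc m - (y - 1/2) ^ Suc m = of_nat (Suc m) * y ^ m + (\<Sum>i<m. d i * y ^ i)"
    using power_difference_sum[of m] by blast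
  define h where "h i x = of_int x ^ Suc i / of_nat (Suc i) + f i x" for i and x :: int
  define g where "g x = (\<Sum>i<m. (- d i / of_nat (Suc m)) * h i x)" for x
  have hd: "h i (x + 1) - h i x = (of_int x + 1/2) ^ i" if "i < m" for i x
    using fd[OF that, of x] by (simp add: h_def diff_divide_distrib algebra_simps del: of_nat_Suc power_Suc)
  have "(\<lambda>x. (- d i / of_nat (Suc m)) * h i x) \<in> pspan (\<lambda>j. 0 < j \<and> j < m \<and> odd (j + m))" if "i < m" for i
  proof (cases "d i = 0")
    case True
    then show ?thesis by (simp add: pspan_def cspan.zero)
  next
    case False
    then have ev: "even (i + m)" using d by blast
    \<comment> \<open>Equal parity of \<open>i\<close> and \<open>m\<close> excludes
      \<open>i = m - 1\<close>, so the leading power of \<open>h i\<close> stays below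
      \<open>m\<close>.\<close>
    with that have "Suc i < m" by (cases "Suc i = m") auto
    then have "(\<lambda>x. of_int x ^ Suc i) \<in> pspan (\<lambda>j. 0 < j \<and> j < m \<and> odd (j + m))"
      using ev by (intro pspan_power) auto
    moreover have "f i \<in> pspan (\<lambda>j. 0 < j \<and> j < m \<and> odd (j + m))"
      by (rule pspan_mono[OF f[OF that]]) (use that ev in auto)
    ultimately have "(\<lambda>x. f i x + 1 / of_nat (Suc i) * of_int x ^ Suc i) \<in> pspan (\<lambda>j. 0 < j \<and> j < m \<and> odd (j + m))"
      unfolding pspan_def by (intro cspan_add_scaled)
    moreover have "h i = (\<lambda>x. f i x + 1 / of_nat (Suc i) * of_int x ^ Suc i)"
      by (simp add: h_def fun_eq_iff)
    ultimately show ?thesis unfolding pspan_def by (intro cspan_scale) simp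
  qed
  then have "g \<in> pspan (\<lambda>j. 0 < j \<and> j < m \<and> odd (j + m))"
    unfolding pspan_def g_def by (intro cspan_sum) auto
  moreover have "(of_int (x + 1) ^ Suc m - of_int x ^ Suc m) / of_nat (Suc m) + (g (x + 1) - g x) = (of_int x + 1/2) ^ m" for x
  proof -
    have "g (x + 1) - g x = (\<Sum>i<m. (- d i / of_nat (Suc m)) * (h i (x + 1) - h i x))"
      unfolding g_def right_diff_distrib sum_subtractf ..
    also have "\<dots> = - (\<Sum>i<m. d i * (of_int x + 1/2) ^ i) / of_nat (Suc m)"
      by (simp add: hd sum_divide_distrib sum_negf)
    finally have g: "g (x + 1) - g x = - (\<Sum>i<m. d i * (of_int x + 1/2) ^ i) / of_nat (Suc m)" .
    have "of_int (x + 1) ^ Suc m - of_int x ^ Suc m =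
        of_nat (Suc m) * (of_int x + 1/2) ^ m + (\<Sum>i<m. d i * (of_int x + 1/2) ^ i)"
      using dy[of "of_int x + 1/2"] by (simp add: add.assoc del: of_nat_Suc power_Suc)
    then show ?thesis
      unfolding g by (simp add: add_divide_distrib del: of_nat_Suc power_Suc)
  qed
  ultimately show ?case by blast
qed

text \<open>With half of the endpoint term added, this is the trapezoidal sum over [0, x]. Its
  difference is the average of \<open>x ^ m\<close> and \<open>(x + 1) ^ m\<close>, of parity
  \<open>m\<close> in \<open>x + 1/2\<close>, so the sum itself has parity \<open>m + 1\<close> in
  \<open>x\<close>. In Faulhaber's formula only the Bernoulli number of index 1 breaks the parity,
  and the half term removes it.\<close>

lemma power_sum_parity:
  assumes "m > 0"
  shows "\<exists>g\<in>pspan (\<lambda>i. 0 < i \<and> i < m \<and> odd (i + m)). \<forall>x>0.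
    (\<Sum>n\<in>{0<..<x}. of_int n ^ m) + of_int x ^ m / 2 = of_int x ^ Suc m / of_nat (Suc m) + g x"
proof -
  obtain f where f: "\<And>i. f i \<in> pspan (\<lambda>j. 0 < j \<and> j < i \<and> odd (j + i))"
    and fd: "\<And>i x.
      (of_int (x + 1) ^ Suc i - of_int x ^ Suc i) / of_nat (Suc i) + (f i (x + 1) - f i x) = (of_int x + 1/2) ^ i"
  proof -
    have "\<forall>i. \<exists>f. f \<in> pspan (\<lambda>j. 0 < j \<and> j < i \<and> odd (j + i)) \<and> (\<forall>x.
        (of_int (x + 1) ^ Suc i - of_int x ^ Suc i) / of_nat (Suc i) + (f (x + 1) - f x) = (of_int x + 1/2) ^ i)"
      using shifted_power_antidifference by blast
    from choice[OF this] show ?thesis using that by blast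
  qed
  obtain d where d: "\<And>i. even (i + m) \<or> d i = 0"
    and dy: "\<And>y :: complex. ((y + 1/2) ^ m + (y - 1/2) ^ m) / 2 = y ^ m + (\<Sum>i<m. d i * y ^ i)"
    using power_average_sum[of m] by blast
  define h where "h i x = of_int x ^ Suc i / of_nat (Suc i) + f i x" for i and x :: int
  define g where "g x = f m x + (\<Sum>i<m. d i * h i x)" for x
  have hd: "h i (x + 1) - h i x = (of_int x + 1/2) ^ i" for i x
    using fd[of x i] by (simp add: h_def diff_divide_distrib algebra_simps del: of_nat_Suc power_Suc)
  have "(\<lambda>x. d i * h i x) \<in> pspan (\<lambda>j. 0 < j \<and> j < m \<and> odd (j + m))" if "i < m" for i
  proof (cases "d i = 0")
    case True
    then show ?thesis by (simp add: pspan_def cspan.zero)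
  next
    case False
    then have ev: "even (i + m)" using d by blast
    with that have "Suc i < m" by (cases "Suc i = m") auto
    then have "(\<lambda>x. of_int x ^ Suc i) \<in> pspan (\<lambda>j. 0 < j \<and> j < m \<and> odd (j + m))"
      using ev by (intro pspan_power) auto
    moreover have "f i \<in> pspan (\<lambda>j. 0 < j \<and> j < m \<and> odd (j + m))"
      by (rule pspan_mono[OF f]) (use that ev in auto)
    ultimately have "(\<lambda>x. f i x + 1 / of_nat (Suc i) * of_int x ^ Suc i) \<in> pspan (\<lambda>j. 0 < j \<and> j < m \<and> odd (j + m))"
      unfolding pspan_def by (intro cspan_add_scaled)
    moreover have "h i = (\<lambda>x. f i x + 1 / of_nat (Suc i) * of_int x ^ Suc i)"
      by (simp add: h_def fun_eq_iff)
    ultimately show ?thesis unfolding pspan_def by (intro cspan_scale) simp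
  qed
  then have gs: "g \<in> pspan (\<lambda>j. 0 < j \<and> j < m \<and> odd (j + m))"
    using f[of m] unfolding pspan_def g_def by (intro cspan_plus cspan_sum) auto
  define G where "G x = of_int x ^ Suc m / of_nat (Suc m) + g x" for x
  \<comment> \<open>Only positive exponents occur in \<open>g\<close>; this fixes the constant of
    summation.\<close>
  have G0: "G 0 = 0"
  proof -
    have "g 0 = 0" if "g \<in> pspan (\<lambda>j. 0 < j \<and> j < m \<and> odd (j + m))" for g
      using that unfolding pspan_def by (induction rule: cspan.induct) auto
    with gs show ?thesis by (simp add: G_def)
  qed
  have Gd: "G (x + 1) - G x = (of_int (x + 1) ^ m + of_int x ^ m) / 2" for x
  proof -
    have "G x = h m x + (\<Sum>i<m. d i * h i x)" for x
      by (simp add: G_def g_def h_def)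
    then have "G (x + 1) - G x = (h m (x + 1) - h m x) + (\<Sum>i<m. d i * (h i (x + 1) - h i x))"
      unfolding right_diff_distrib sum_subtractf by simp
    also have "\<dots> = ((of_int x + 1/2 + 1/2) ^ m + (of_int x + 1/2 - 1/2) ^ m) / 2"
      unfolding hd dy ..
    finally show ?thesis by (simp add: add.commute)
  qed
  have "(\<Sum>n\<in>{0<..<x}. of_int n ^ m) + of_int x ^ m / 2 = G x" if "0 < x" for x
  proof -
    from that have "1 \<le> x" by simp
    then show ?thesis
    proof (induction x rule: int_ge_induct)
      case base
      have e: "{0<..<1::int} = {}" by auto
      show ?case using Gd[of 0] G0 assms by (simp add: e)
    next
      case (step x)
      then have "{0<..<x + 1} = insert x {0<..<x}" by auto
      then have "(\<Sum>n\<in>{0<..<x + 1}. of_int n ^ m :: complex) = of_int x ^ m + (\<Sum>n\<in>{0<..<x}. of_int n ^ m)"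
        by simp
      with step.IH Gd[of x] show ?case by (simp add: field_simps)
    qed
  qed
  with gs show ?thesis unfolding G_def by blast
qed

text \<open>For \<open>r > 0\<close> the boundary terms \<open>x ^ m / 2\<close> of \<open>power_sum_parity\<close> add up to \<open>x ^ p * (x - x) ^ r / 2 = 0\<close>.\<close>

lemma power_convolution_parity:
  assumes "p > 0" "r > 0"
  shows "\<exists>g\<in>pspan (\<lambda>i. i < p + r + 1 \<and> odd (i + p + r)). \<forall>x>0.
    (\<Sum>n\<in>{0<..<x}. of_int n ^ p * of_int (x - n) ^ r) =
    (\<Sum>j\<le>r. of_nat (r choose j) * (-1) ^ j / of_nat (p + j + 1)) * of_int x ^ (p + r + 1) + g x"
proof -
  have "\<forall>m. \<exists>g. m > 0 \<longrightarrow> g \<in> pspan (\<lambda>i. 0 < i \<and> i < m \<and> odd (i + m)) \<and> (\<forall>x>0.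
    (\<Sum>n\<in>{0<..<x}. of_int n ^ m) + of_int x ^ m / 2 = of_int x ^ Suc m / of_nat (Suc m) + g x)"
    using power_sum_parity by blast
  from choice[OF this] obtain f where f: "\<And>m. m > 0 \<Longrightarrow> f m \<in> pspan (\<lambda>i. 0 < i \<and> i < m \<and> odd (i + m))"
    and fs: "\<And>m x. m > 0 \<Longrightarrow> x > 0 \<Longrightarrow>
      (\<Sum>n\<in>{0<..<x}. of_int n ^ m) + of_int x ^ m / 2 = of_int x ^ Suc m / of_nat (Suc m) + f m x"
    by blast
  define c :: "nat \<Rightarrow> complex" where "c j = of_nat (r choose j) * (-1) ^ j" for j
  define g where "g x = (\<Sum>j\<le>r. c j * (of_int x ^ (r - j) * f (p + j) x))" for x
  have "(\<lambda>x. of_int x ^ (r - j) * f (p + j) x) \<in> pspan (\<lambda>i. i < p + r + 1 \<and> odd (i + p + r))" if "j \<le> r" for j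
    by (rule pspan_mult[OF pspan_power[of "\<lambda>i. i = r - j"] f]) (use that assms in auto)
  then have "g \<in> pspan (\<lambda>i. i < p + r + 1 \<and> odd (i + p + r))"
    unfolding g_def pspan_def by (intro cspan_sum cspan_scale) auto
  moreover have "(\<Sum>n\<in>{0<..<x}. of_int n ^ p * of_int (x - n) ^ r) =
      (\<Sum>j\<le>r. c j / of_nat (p + j + 1)) * of_int x ^ (p + r + 1) + g x" if x: "x > 0" for x
  proof -
    have expand: "t ^ p * (of_int x - t) ^ r = (\<Sum>j\<le>r. c j * of_int x ^ (r - j) * t ^ (p + j))" for t :: complex
    proof -
      have e1: "(of_int x - t) ^ r = (\<Sum>j\<le>r. of_nat (r choose j) * (- t) ^ j * of_int x ^ (r - j))"
        using binomial_ring[of "- t" "of_int x" r] by simp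
      have e2: "t ^ p * (of_nat (r choose j) * (- t) ^ j * of_int x ^ (r - j)) =
          c j * of_int x ^ (r - j) * t ^ (p + j)" for j
        unfolding c_def power_minus[of t j] power_add by (simp only: mult_ac)
      show ?thesis unfolding e1 sum_distrib_left e2 ..
    qed
    have "(\<Sum>j\<le>r. c j * of_int x ^ (r - j) * of_int x ^ (p + j)) = 0"
      using expand[of "of_int x"] assms by (simp add: zero_power)
    then have z: "(\<Sum>j\<le>r. c j * of_int x ^ (r - j) * (of_int x ^ (p + j) / 2)) = 0"
      by (simp flip: sum_divide_distrib)
    have "(\<Sum>n\<in>{0<..<x}. of_int n ^ p * of_int (x - n) ^ r) =
        (\<Sum>n\<in>{0<..<x}. \<Sum>j\<le>r. c j * of_int x ^ (r - j) * of_int n ^ (p + j))"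
      by (simp add: expand)
    also have "\<dots> = (\<Sum>j\<le>r. c j * of_int x ^ (r - j) * (\<Sum>n\<in>{0<..<x}. of_int n ^ (p + j)))"
      by (subst sum.swap) (simp add: sum_distrib_left)
    also have "\<dots> = (\<Sum>j\<le>r. c j * of_int x ^ (r - j) * (\<Sum>n\<in>{0<..<x}. of_int n ^ (p + j))) +
        (\<Sum>j\<le>r. c j * of_int x ^ (r - j) * (of_int x ^ (p + j) / 2))"
      by (simp only: z add_0_right)
    also have "\<dots> = (\<Sum>j\<le>r. c j * of_int x ^ (r - j) * ((\<Sum>n\<in>{0<..<x}. of_int n ^ (p + j)) + of_int x ^ (p + j) / 2))"
      by (simp add: sum.distrib distrib_left)
    also have "\<dots> = (\<Sum>j\<le>r. c j * of_int x ^ (r - j) * (of_int x ^ Suc (p + j) / of_nat (Suc (p + j)) + f (p + j) x))"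
      by (intro sum.cong refl) (use fs assms x in simp)
    also have "\<dots> = (\<Sum>j\<le>r. c j / of_nat (p + j + 1) * of_int x ^ (p + r + 1)) + g x"
      unfolding g_def sum.distrib[symmetric]
    proof (intro sum.cong refl)
      fix j assume "j \<in> {..r}"
      then have "(of_int x :: complex) ^ (p + r + 1) = of_int x ^ (r - j) * of_int x ^ Suc (p + j)"
        by (simp add: add.commute flip: power_add)
      then show "c j * of_int x ^ (r - j) * (of_int x ^ Suc (p + j) / of_nat (Suc (p + j)) + f (p + j) x) =
          c j / of_nat (p + j + 1) * of_int x ^ (p + r + 1) + c j * (of_int x ^ (r - j) * f (p + j) x)"
        by (simp add: algebra_simps del: power_Suc)
    qed
    finally show ?thesis by (simp add: sum_distrib_right)
  qed
  ultimately show ?thesis unfolding c_def by blast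
qed


subsection \<open>The ring of quasi-modular forms\<close>

lemma quasi_modular_zero: "0 \<in> quasi_modular"
  unfolding quasi_modular_def by (rule CollectI, rule exI[of _ "{}"]) simp

lemma quasi_modular_monomial:
  "fps_const c * eisenstein 1 ^ i * eisenstein 2 ^ j * eisenstein 3 ^ l \<in> quasi_modular"
  unfolding quasi_modular_def
  by (rule CollectI, rule exI[of _ "{(i, j, l)}"], rule exI[of _ "\<lambda>_ _ _. c"]) simp

lemma quasi_modular_add:
  assumes "F \<in> quasi_modular" "G \<in> quasi_modular" shows "F + G \<in> quasi_modular"
proof -
  from assms obtain A B c d where fin: "finite A" "finite B"
    and F: "F = (\<Sum>(i, j, l)\<in>A. fps_const (c i j l) * eisenstein 1 ^ i * eisenstein 2 ^ j * eisenstein 3 ^ l)"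
    and G: "G = (\<Sum>(i, j, l)\<in>B. fps_const (d i j l) * eisenstein 1 ^ i * eisenstein 2 ^ j * eisenstein 3 ^ l)"
    unfolding quasi_modular_def by blast
  define e where "e i j l = (if (i, j, l) \<in> A then c i j l else 0) + (if (i, j, l) \<in> B then d i j l else 0)"
    for i j l
  have F': "F = (\<Sum>(i, j, l)\<in>A \<union> B. fps_const (if (i, j, l) \<in> A then c i j l else 0) * eisenstein 1 ^ i * eisenstein 2 ^ j * eisenstein 3 ^ l)"
    unfolding F using fin by (intro sum.mono_neutral_cong_left) auto
  have G': "G = (\<Sum>(i, j, l)\<in>A \<union> B. fps_const (if (i, j, l) \<in> B then d i j l else 0) * eisenstein 1 ^ i * eisenstein 2 ^ j * eisenstein 3 ^ l)"
    unfolding G using fin by (intro sum.mono_neutral_cong_left) auto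
  have "F + G = (\<Sum>(i, j, l)\<in>A \<union> B. fps_const (e i j l) * eisenstein 1 ^ i * eisenstein 2 ^ j * eisenstein 3 ^ l)"
    unfolding F' G' sum.distrib[symmetric] e_def fps_const_add[symmetric]
    by (intro sum.cong refl) (simp only: case_prod_unfold distrib_right)
  with fin show ?thesis
    unfolding quasi_modular_def by (intro CollectI exI[of _ "A \<union> B"] exI[of _ e]) auto
qed

lemma quasi_modular_sum: "(\<And>i. i \<in> A \<Longrightarrow> F i \<in> quasi_modular) \<Longrightarrow> (\<Sum>i\<in>A. F i) \<in> quasi_modular"
  by (induction A rule: infinite_finite_induct) (auto intro: quasi_modular_zero quasi_modular_add)

lemma quasi_modular_mult:
  assumes "F \<in> quasi_modular" "G \<in> quasi_modular" shows "F * G \<in> quasi_modular"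
proof -
  from assms obtain A B c d where fin: "finite A" "finite B"
    and F: "F = (\<Sum>(i, j, l)\<in>A. fps_const (c i j l) * eisenstein 1 ^ i * eisenstein 2 ^ j * eisenstein 3 ^ l)"
    and G: "G = (\<Sum>(i, j, l)\<in>B. fps_const (d i j l) * eisenstein 1 ^ i * eisenstein 2 ^ j * eisenstein 3 ^ l)"
    unfolding quasi_modular_def by blast
  have eq: "(fps_const a * eisenstein 1 ^ i * eisenstein 2 ^ j * eisenstein 3 ^ l) *
      (fps_const b * eisenstein 1 ^ i' * eisenstein 2 ^ j' * eisenstein 3 ^ l') =
      fps_const (a * b) * eisenstein 1 ^ (i + i') * eisenstein 2 ^ (j + j') * eisenstein 3 ^ (l + l')"
    for a b i j l i' j' l'
    unfolding power_add fps_const_mult[symmetric] by (simp only: mult_ac)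
  have "(case x of (i, j, l) \<Rightarrow> fps_const (c i j l) * eisenstein 1 ^ i * eisenstein 2 ^ j * eisenstein 3 ^ l) *
      (case y of (i, j, l) \<Rightarrow> fps_const (d i j l) * eisenstein 1 ^ i * eisenstein 2 ^ j * eisenstein 3 ^ l)
      \<in> quasi_modular" for x y
    by (cases x; cases y) (simp only: prod.case eq quasi_modular_monomial)
  then show ?thesis
    unfolding F G sum_product by (intro quasi_modular_sum)
qed

lemma quasi_modular_const: "fps_const c \<in> quasi_modular"
  using quasi_modular_monomial[of c 0 0 0] by simp

lemma quasi_modular_scale: "F \<in> quasi_modular \<Longrightarrow> fps_const c * F \<in> quasi_modular"
  by (intro quasi_modular_mult quasi_modular_const)

lemma quasi_modular_diff: "F \<in> quasi_modular \<Longrightarrow> G \<in> quasi_modular \<Longrightarrow> F - G \<in> quasi_modular"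
  using quasi_modular_add[OF _ quasi_modular_scale[of G "-1"], of F] by (simp flip: fps_const_neg)

lemma quasi_modular_scale_cancel:
  assumes "fps_const c * F \<in> quasi_modular" "c \<noteq> 0" shows "F \<in> quasi_modular"
proof -
  have "fps_const (1 / c) * (fps_const c * F) = F"
    unfolding mult.assoc[symmetric] fps_const_mult using assms(2) by simp
  then show ?thesis using quasi_modular_scale[OF assms(1), of "1 / c"] by (simp only:)
qed

lemma quasi_modular_eisenstein: "j \<in> {1, 2, 3} \<Longrightarrow> eisenstein j \<in> quasi_modular"
  using quasi_modular_monomial[of 1 1 0 0] quasi_modular_monomial[of 1 0 1 0] quasi_modular_monomial[of 1 0 0 1]
  by auto

lemma quasi_modular_induct [consumes 1, case_names const gens add mult]:
  assumes "F \<in> quasi_modular"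
    and const: "\<And>c. P (fps_const c)"
    and gens: "\<And>j. j \<in> {1, 2, 3} \<Longrightarrow> P (eisenstein j)"
    and add: "\<And>F G. P F \<Longrightarrow> P G \<Longrightarrow> P (F + G)"
    and mult: "\<And>F G. P F \<Longrightarrow> P G \<Longrightarrow> P (F * G)"
  shows "P F"
proof -
  from assms(1) obtain A c where F: "finite A"
    "F = (\<Sum>(i, j, l)\<in>A. fps_const (c i j l) * eisenstein 1 ^ i * eisenstein 2 ^ j * eisenstein 3 ^ l)"
    unfolding quasi_modular_def by blast
  have pow: "P (G ^ n)" if "P G" for G n
    using that const[of 1] by (induction n) (auto intro: mult)
  have "P (fps_const c * eisenstein 1 ^ i * eisenstein 2 ^ j * eisenstein 3 ^ l)" for c i j l
    by (intro mult pow const gens) auto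
  then have "P (case p of (i, j, l) \<Rightarrow> fps_const (c i j l) * eisenstein 1 ^ i * eisenstein 2 ^ j * eisenstein 3 ^ l)" for p
    by (cases p) simp
  with F(1) show ?thesis
    unfolding F(2) using const[of 0] by (induction A rule: finite_induct) (auto intro: add)
qed

section \<open>Eisenstein series as Lambert series\<close>

text \<open>Nonvanishing allows the series of \<open>a\<close>, \<open>a ^ 3\<close> and
  \<open>a ^ 5\<close> to be recovered from the Eisenstein series. The quotients of Bernoulli
  numbers by factorials are the coefficients of the inverse of \<open>h = (e^t - 1) / t\<close>,
  solved for one degree at a time from \<open>f * h = 1\<close>; the values behind them are 1/6,
  -1/30 and 1/42.\<close>

lemma bernoulli_number_nonzero:
  "bernoulli_number 2 \<noteq> 0" "bernoulli_number 4 \<noteq> 0" "bernoulli_number 6 \<noteq> 0"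
proof -
  define h :: "complex fps" where "h = Abs_fps (\<lambda>n. 1 / fact (Suc n))"
  have h: "fps_nth h n = 1 / fact (Suc n)" for n by (simp add: h_def)
  have "fps_exp 1 - 1 = fps_X * h"
  proof (rule fps_ext)
    fix n show "fps_nth (fps_exp 1 - 1) n = fps_nth (fps_X * h) n"
      by (cases n) (auto simp: h_def simp del: fact_Suc)
  qed
  then have "fps_X / (fps_exp 1 - 1) = (fps_X * 1) / (fps_X * h)" by simp
  also have "\<dots> = 1 / h" by (rule div_mult_mult1) simp
  finally have q: "fps_X / (fps_exp 1 - 1) = inverse h"
    using h[of 0] by (simp add: fps_divide_unit)
  define f where "f = inverse h"
  have "f * h = 1" unfolding f_def by (rule inverse_mult_eq_1) (simp add: h)
  then have e: "(\<Sum>i=0..n. fps_nth f i * (1 / fact (Suc (n - i)))) = (if n = 0 then 1 else 0)" for n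
    by (metis (no_types, lifting) fps_mult_nth fps_one_nth h sum.cong)
  have f0: "fps_nth f 0 = 1" using e[of 0] by simp
  have f1: "fps_nth f (Suc 0) = - 1/2"
    using e[of "Suc 0"] f0 by (simp add: field_simps eq_neg_iff_add_eq_0)
  have f2: "fps_nth f (Suc (Suc 0)) = 1/12"
    using e[of "Suc (Suc 0)"] f0 f1 by (simp add: field_simps)
  have f3: "fps_nth f (Suc (Suc (Suc 0))) = 0"
    using e[of "Suc (Suc (Suc 0))"] f0 f1 f2 by (simp add: field_simps)
  have f4: "fps_nth f (Suc (Suc (Suc (Suc 0)))) = - 1/720"
    using e[of "Suc (Suc (Suc (Suc 0)))"] f0 f1 f2 f3 by (simp add: field_simps eq_neg_iff_add_eq_0)
  have f5: "fps_nth f (Suc (Suc (Suc (Suc (Suc 0))))) = 0"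
    using e[of "Suc (Suc (Suc (Suc (Suc 0))))"] f0 f1 f2 f3 f4 by (simp add: field_simps)
  have f6: "fps_nth f (Suc (Suc (Suc (Suc (Suc (Suc 0)))))) = 1/30240"
    using e[of "Suc (Suc (Suc (Suc (Suc (Suc 0)))))"] f0 f1 f2 f3 f4 f5 by (simp add: field_simps)
  show "bernoulli_number 2 \<noteq> 0" "bernoulli_number 4 \<noteq> 0" "bernoulli_number 6 \<noteq> 0"
    using arg_cong[OF f2, of "\<lambda>z. z = 0"] arg_cong[OF f4, of "\<lambda>z. z = 0"] arg_cong[OF f6, of "\<lambda>z. z = 0"]
    unfolding bernoulli_number_def q f_def[symmetric] by (simp_all add: numeral_eq_Suc)
qed

lemma has_sum_lambert:
  "((\<lambda>n. of_nat n ^ e * fps_X ^ n / (1 - fps_X ^ n)) has_sum lam1 (\<lambda>a x. of_int a ^ e)) {1..}"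
proof -
  have e1: "gen {1..} (\<lambda>u. n * u) (\<lambda>_. of_nat n ^ e) = of_nat n ^ e * fps_X ^ n / (1 - fps_X ^ n)"
    if n: "n \<in> {1..}" for n
  proof -
    have u: "fps_nth (1 - fps_X ^ n :: complex fps) 0 \<noteq> 0" using n by simp
    have "fps_X ^ n / (1 - fps_X ^ n) = gen {1..} (\<lambda>u. n * u) (\<lambda>u. 1)"
      using fps_X_power_divide_eq_gen[of n 1 0] n by simp
    then have "fps_const (of_nat n ^ e) * (fps_X ^ n / (1 - fps_X ^ n)) =
        gen {1..} (\<lambda>u. n * u) (\<lambda>u. of_nat n ^ e)"
      using gen_add[of "{1..}" "\<lambda>u. n * u" "\<lambda>_. 0" "of_nat n ^ e" "\<lambda>_. 1"] by (simp add: gen_zero)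
    moreover have "of_nat n ^ e = fps_const (of_nat n ^ e :: complex)"
      by (simp add: fps_of_nat[symmetric])
    ultimately show ?thesis by (simp add: fps_divide_unit[OF u] mult.assoc)
  qed
  have e2: "((\<lambda>n. gen {1..} (\<lambda>u. n * u) (\<lambda>_. of_nat n ^ e)) has_sum
      gen (Sigma {1..} (\<lambda>_. {1..})) (\<lambda>(n, u). n * u) (\<lambda>(n, u). of_nat n ^ e)) {1..}"
  proof (rule has_sum_gen)
    fix N :: nat
    show "finite {p \<in> {1..} \<times> {1..}. (case p of (n, u) \<Rightarrow> n * u) = N}"
      by (rule finite_subset[of _ "{..N} \<times> {..N}"]) auto
  qed
  have e3: "gen (Sigma {1..} (\<lambda>_. {1..})) (\<lambda>(n, u). n * u) (\<lambda>(n, u). of_nat n ^ e) =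
      lam1 (\<lambda>a x. of_int a ^ e)"
    unfolding lam1_def
    by (rule gen_reindex[of _ "\<lambda>(a, x). (nat a, nat x)" "\<lambda>(n, u). (int n, int u)"])
       (auto simp: nat_mult_distrib)
  show ?thesis
    using e2 unfolding e3 by (subst (asm) has_sum_cong[OF e1])
qed

lemma eisenstein_eq_lam1:
  "eisenstein j = 1 - fps_const (4 * of_nat j / bernoulli_number (2 * j)) * lam1 (\<lambda>a x. of_int a ^ (2 * j - 1))"
  unfolding eisenstein_def using infsumI[OF has_sum_lambert] by simp

lemma quasi_modular_lam1_small:
  assumes "j \<in> {1, 2, 3}"
  shows "lam1 (\<lambda>a x. of_int a ^ (2 * j - 1)) \<in> quasi_modular"
proof (rule quasi_modular_scale_cancel)
  let ?c = "4 * of_nat j / bernoulli_number (2 * j)"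
  show "?c \<noteq> 0" using assms bernoulli_number_nonzero by auto
  have "fps_const ?c * lam1 (\<lambda>a x. of_int a ^ (2 * j - 1)) = fps_const 1 - eisenstein j"
    by (simp add: eisenstein_eq_lam1)
  then show "fps_const ?c * lam1 (\<lambda>a x. of_int a ^ (2 * j - 1)) \<in> quasi_modular"
    by (simp only: quasi_modular_diff quasi_modular_const quasi_modular_eisenstein assms)
qed

subsection \<open>Relations between products of Lambert series\<close>

lemma lam2_split:
  "lam2 \<phi> = lam2 (\<lambda>a b x y. if y < x then \<phi> a b x y else 0) +
    lam2 (\<lambda>a b x y. if x < y then \<phi> a b x y else 0) + lam2 (\<lambda>a b x y. if x = y then \<phi> a b x y else 0)"
  unfolding lam2_plus[symmetric] by (rule lam2_cong) auto

lemma lam2_split':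
  "lam2 \<phi> = lam2 (\<lambda>a b x y. if a < b then \<phi> a b x y else 0) +
    lam2 (\<lambda>a b x y. if b < a then \<phi> a b x y else 0) + lam2 (\<lambda>a b x y. if a = b then \<phi> a b x y else 0)"
  unfolding lam2_plus[symmetric] by (rule lam2_cong) auto

text \<open>Split the sum of \<open>h a b\<close> by comparing \<open>x\<close> with
  \<open>y\<close>, and that of \<open>h a (- b)\<close> by comparing \<open>a\<close> with
  \<open>b\<close>. The shear carries one kind of half to the other, so all four halves equal
  \<open>?T\<close> and cancel in the difference; only the two diagonals remain. The hypotheses hold
  for every function of a, b, -(a + b) that is symmetric and invariant under a common change of
  sign.\<close>

lemma lam2_difference_relation:
  fixes h :: "int \<Rightarrow> int \<Rightarrow> complex"
  assumes sym: "\<And>a b. h a b = h b a" and even: "\<And>a b. h a (- b) = h b (- a)"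
    and shear: "\<And>a b. h a (b - a) = h a (- b)"
  shows "lam2 (\<lambda>a b x y. h a b - h a (- b)) =
    lam1 (\<lambda>N x. \<Sum>a\<in>{0<..<N}. h a (N - a)) - lam1 (\<lambda>a N. of_int (N - 1) * h a (- a))"
proof -
  let ?T = "lam2 (\<lambda>a b x y. if a < b then h a (- b) else 0)"
  have 1: "lam2 (\<lambda>a b x y. if y < x then h a b else 0) = ?T"
    unfolding lam2_shear[of "\<lambda>a b x y. h a b"] by (rule lam2_cong) (simp add: shear)
  have 2: "lam2 (\<lambda>a b x y. if x < y then h a b else 0) = ?T"
    unfolding 1[symmetric] by (subst lam2_swap, rule lam2_cong) (metis sym)
  have 3: "lam2 (\<lambda>a b x y. if x = y then h a b else 0) = lam1 (\<lambda>N x. \<Sum>a\<in>{0<..<N}. h a (N - a))"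
    using lam2_diagonal[of "\<lambda>a b x. h a b"] .
  have 4: "lam2 (\<lambda>a b x y. if b < a then h a (- b) else 0) = ?T"
    by (subst lam2_swap, rule lam2_cong) (metis even)
  have "lam2 (\<lambda>a b x y. if a = b then h a (- b) else 0) = lam2 (\<lambda>a b x y. if x = y then h x (- x) else 0)"
    by (subst lam2_dual) (rule lam2_cong, simp)
  also have "\<dots> = lam1 (\<lambda>N x. \<Sum>a\<in>{0<..<N}. h x (- x))"
    using lam2_diagonal[of "\<lambda>a b x. h x (- x)"] .
  \<comment> \<open>\<open>N - 1\<close> counts the decompositions of \<open>N\<close> into two
    positive parts; before the exchange of the two pairs of variables these are
    \<open>N = x + y\<close>.\<close>
  also have "\<dots> = lam1 (\<lambda>a N. of_int (N - 1) * h a (- a))"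
    by (subst lam1_swap) (rule lam1_cong, simp)
  finally have 5: "lam2 (\<lambda>a b x y. if a = b then h a (- b) else 0) = lam1 (\<lambda>a N. of_int (N - 1) * h a (- a))" .
  have "lam2 (\<lambda>a b x y. h a b) = ?T + ?T + lam1 (\<lambda>N x. \<Sum>a\<in>{0<..<N}. h a (N - a))"
    by (subst lam2_split) (simp only: 1 2 3)
  moreover have "lam2 (\<lambda>a b x y. h a (- b)) = ?T + ?T + lam1 (\<lambda>a N. of_int (N - 1) * h a (- a))"
    by (subst lam2_split') (simp only: 4 5)
  ultimately show ?thesis by (simp add: lam2_minus)
qed

text \<open>Reflection doubles the monomials that are odd in the second variable and removes the
  others. When the total degree is even, both remaining exponents are odd, and the double series is
  a combination of products of odd-power series.\<close>

lemma bspan_difference: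
  assumes "f \<in> bspan P"
  shows "(\<lambda>p. f p - f (fst p, - snd p)) \<in> bspan (\<lambda>i j. P i j \<and> odd j)"
  using assms unfolding bspan_def
proof (induction rule: cspan.induct)
  case zero
  show ?case by (simp add: cspan.zero)
next
  case (add f g c)
  let ?B = "{(\<lambda>p :: int \<times> int. of_int (fst p) ^ i * of_int (snd p) ^ j :: complex) | i j. P i j \<and> odd j}"
  from add obtain i j where ij: "P i j" "g = (\<lambda>p. of_int (fst p) ^ i * of_int (snd p) ^ j)" by auto
  have "(\<lambda>p. g p - g (fst p, - snd p)) \<in> cspan ?B"
  proof (cases "even j")
    case True
    then show ?thesis by (simp add: ij cspan.zero)
  next
    case False
    then have "(\<lambda>p. 2 * g p) \<in> cspan ?B"
      using ij by (intro cspan_scale cspan_base) auto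
    with False show ?thesis by (simp add: ij)
  qed
  from cspan_add_scaled[OF this add.IH, of c] show ?case
    by (simp add: algebra_simps)
qed

lemma quasi_modular_lam1_pspan:
  assumes "f \<in> pspan P" "\<And>i. P i \<Longrightarrow> lam1 (\<lambda>a x. of_int a ^ i) \<in> quasi_modular"
  shows "lam1 (\<lambda>a x. f a) \<in> quasi_modular"
  using assms(1) unfolding pspan_def
  by (induction rule: cspan.induct)
     (auto simp: lam1_add intro!: quasi_modular_zero quasi_modular_add quasi_modular_scale assms(2))

lemma quasi_modular_lam2_bspan:
  assumes "f \<in> bspan P"
    "\<And>i j. P i j \<Longrightarrow> lam1 (\<lambda>a x. of_int a ^ i) \<in> quasi_modular \<and> lam1 (\<lambda>a x. of_int a ^ j) \<in> quasi_modular"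
  shows "lam2 (\<lambda>a b x y. f (a, b)) \<in> quasi_modular"
  using assms(1) unfolding bspan_def
  by (induction rule: cspan.induct)
     (auto simp: lam2_add lam2_product intro!: quasi_modular_zero quasi_modular_add quasi_modular_scale quasi_modular_mult dest: assms(2))

section \<open>Odd-power series, their recursion and their derivatives\<close>

lemma bspan_sum_power: "(\<lambda>p. of_int (fst p + snd p) ^ n) \<in> bspan (\<lambda>i j. i + j = n)"
proof -
  have "(\<lambda>p :: int \<times> int. of_int (fst p + snd p) ^ n :: complex) =
      (\<lambda>p. \<Sum>k\<le>n. of_nat (n choose k) * (of_int (fst p) ^ k * of_int (snd p) ^ (n - k)))"
    by (simp add: binomial_ring mult.assoc)
  also have "\<dots> \<in> bspan (\<lambda>i j. i + j = n)"
    using bspan_power[of "\<lambda>i j. i + j = n"] unfolding bspan_def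
    by (intro cspan_sum cspan_scale) auto
  finally show ?thesis .
qed

lemma bspan_power_triple:
  "(\<lambda>p. of_int (fst p) ^ n + of_int (snd p) ^ n + of_int (fst p + snd p) ^ n) \<in> bspan (\<lambda>i j. i + j = n)"
  using bspan_power[of "\<lambda>i j. i + j = n" n 0] bspan_power[of "\<lambda>i j. i + j = n" 0 n] bspan_sum_power[of n]
  unfolding bspan_def by (auto intro!: cspan_plus)

text \<open>
  The relation for \<open>a\<^sup>2 b\<^sup>2 (a + b)\<^sup>2 (a ^ n + b ^ n + (a + b) ^ n)\<close>; the leading coefficient of the
  diagonal term is positive, so that it can be solved for the series of \<open>a ^ (n + 7)\<close>.
\<close>

lemma quasi_modular_lam1_step:
  assumes n: "even n" and IH: "\<And>i. odd i \<Longrightarrow> i < n + 7 \<Longrightarrow> lam1 (\<lambda>a x. of_int a ^ i) \<in> quasi_modular"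
  shows "lam1 (\<lambda>a x. of_int a ^ (n + 7)) \<in> quasi_modular"
proof -
  \<comment> \<open>The squares make \<open>f\<close> vanish at \<open>b = - a\<close>, which
    removes the diagonal term with the factor \<open>N - 1\<close>, a derivative. They also keep all
    exponents in the remaining convolutions positive, so that these have a definite parity.\<close>
  define f :: "int \<times> int \<Rightarrow> complex" where
    "f p = of_int (fst p) ^ 2 * of_int (snd p) ^ 2 * of_int (fst p + snd p) ^ 2 *
       (of_int (fst p) ^ n + of_int (snd p) ^ n + of_int (fst p + snd p) ^ n)" for p
  have f: "f \<in> bspan (\<lambda>i j. 2 \<le> i \<and> 2 \<le> j \<and> i + j = n + 6)"
  proof -
    have "(\<lambda>p. of_int (fst p) ^ 2 * of_int (snd p) ^ 2 * of_int (fst p + snd p) ^ 2) \<in>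
        bspan (\<lambda>i j. 2 \<le> i \<and> 2 \<le> j \<and> i + j = 6)"
      by (rule bspan_mult[OF bspan_power[of "\<lambda>i j. i = 2 \<and> j = 2" 2 2] bspan_sum_power[of 2]]) auto
    then show ?thesis
      unfolding f_def by (rule bspan_mult[OF _ bspan_power_triple]) auto
  qed
  have lhs: "lam2 (\<lambda>a b x y. f (a, b) - f (a, - b)) \<in> quasi_modular"
  proof -
    have "lam1 (\<lambda>a x. of_int a ^ i) \<in> quasi_modular \<and> lam1 (\<lambda>a x. of_int a ^ j) \<in> quasi_modular"
      if "(2 \<le> i \<and> 2 \<le> j \<and> i + j = n + 6) \<and> odd j" for i j
    proof -
      have "odd i" "i < n + 7" "odd j" "j < n + 7" using that n by presburger+
      then show ?thesis by (simp add: IH)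
    qed
    from quasi_modular_lam2_bspan[OF bspan_difference[OF f] this] show ?thesis by simp
  qed
  have rel: "lam2 (\<lambda>a b x y. f (a, b) - f (a, - b)) = lam1 (\<lambda>N x. \<Sum>a\<in>{0<..<N}. f (a, N - a))"
  proof -
    have "lam2 (\<lambda>a b x y. f (a, b) - f (a, - b)) =
        lam1 (\<lambda>N x. \<Sum>a\<in>{0<..<N}. f (a, N - a)) - lam1 (\<lambda>a N. of_int (N - 1) * f (a, - a))"
    proof (rule lam2_difference_relation[of "\<lambda>a b. f (a, b)"])
      fix a b :: int
      have e: "(of_int (a - b) :: complex) ^ m = of_int (b - a) ^ m" if "even m" for m
        using that by (metis minus_diff_eq of_int_minus power_minus_even)
      show "f (a, b) = f (b, a)" unfolding f_def by (simp add: algebra_simps)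
      show "f (a, - b) = f (b, - a)" using n e[of 2] e[of n] unfolding f_def by (simp add: algebra_simps)
      show "f (a, b - a) = f (a, - b)" using n e[of 2] e[of n] unfolding f_def by (simp add: algebra_simps)
    qed
    then show ?thesis by (simp add: f_def)
  qed
  obtain g1 where g1: "g1 \<in> pspan (\<lambda>i. i < n + 2 + 2 + 1 \<and> odd (i + (n + 2) + 2))"
    and s1: "\<And>x. x > 0 \<Longrightarrow> (\<Sum>k\<in>{0<..<x}. of_int k ^ (n + 2) * of_int (x - k) ^ 2) =
      (\<Sum>j\<le>2. of_nat (2 choose j) * (-1) ^ j / of_nat (n + 2 + j + 1)) * of_int x ^ (n + 2 + 2 + 1) + g1 x"
    using power_convolution_parity[of "n + 2" 2] by auto
  obtain g2 where g2: "g2 \<in> pspan (\<lambda>i. i < 2 + 2 + 1 \<and> odd (i + 2 + 2))"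
    and s2: "\<And>x. x > 0 \<Longrightarrow> (\<Sum>k\<in>{0<..<x}. of_int k ^ 2 * of_int (x - k) ^ 2) =
      (\<Sum>j\<le>2. of_nat (2 choose j) * (-1) ^ j / of_nat (2 + j + 1)) * of_int x ^ (2 + 2 + 1) + g2 x"
    using power_convolution_parity[of 2 2] by auto
  \<comment> \<open>These are Beta integrals: \<open>c1\<close> is that of t^(n+2) (1 - t)^2 over
    [0, 1], equal to 2 / ((n+3)(n+4)(n+5)), and \<open>c2\<close> is the case \<open>n = 0\<close>,
    equal to 1/30.\<close>
  define c1 :: complex where "c1 = (\<Sum>j\<le>2. of_nat (2 choose j) * (-1) ^ j / of_nat (n + 2 + j + 1))"
  define c2 :: complex where "c2 = (\<Sum>j\<le>2. of_nat (2 choose j) * (-1) ^ j / of_nat (2 + j + 1))"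
  define r where "r x = 2 * (of_int x ^ 2 * g1 x) + of_int x ^ (n + 2) * g2 x" for x
  have r: "r \<in> pspan (\<lambda>i. odd i \<and> i < n + 7)"
  proof -
    have "(\<lambda>x. of_int x ^ 2 * g1 x) \<in> pspan (\<lambda>i. odd i \<and> i < n + 7)"
      by (rule pspan_mult[OF pspan_power[of "\<lambda>i. i = 2"] g1]) (use n in auto)
    moreover have "(\<lambda>x. of_int x ^ (n + 2) * g2 x) \<in> pspan (\<lambda>i. odd i \<and> i < n + 7)"
      by (rule pspan_mult[OF pspan_power[of "\<lambda>i. i = n + 2"] g2]) (use n in auto)
    ultimately show ?thesis
      unfolding pspan_def r_def by (intro cspan_plus cspan_scale)
  qed
  have "(\<Sum>a\<in>{0<..<x}. f (a, x - a)) = r x + (2 * c1 + c2) * of_int x ^ (n + 7)" if x: "x > 0" for x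
  proof -
    have flip: "(\<Sum>a\<in>{0<..<x}. of_int a ^ 2 * of_int (x - a) ^ (n + 2)) =
        (\<Sum>a\<in>{0<..<x}. of_int a ^ (n + 2) * of_int (x - a) ^ 2 :: complex)"
      by (rule sum.reindex_bij_witness[of _ "\<lambda>a. x - a" "\<lambda>a. x - a"]) auto
    have "f (a, x - a) = of_int x ^ 2 * (of_int a ^ (n + 2) * of_int (x - a) ^ 2) +
        of_int x ^ 2 * (of_int a ^ 2 * of_int (x - a) ^ (n + 2)) +
        of_int x ^ (n + 2) * (of_int a ^ 2 * of_int (x - a) ^ 2)" for a
    proof -
      have "of_int (a + (x - a)) = (of_int x :: complex)" by simp
      then show ?thesis
        by (simp only: f_def power_add fst_conv snd_conv) (simp only: algebra_simps)
    qed
    then have "(\<Sum>a\<in>{0<..<x}. f (a, x - a)) =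
        of_int x ^ 2 * (\<Sum>a\<in>{0<..<x}. of_int a ^ (n + 2) * of_int (x - a) ^ 2) +
        of_int x ^ 2 * (\<Sum>a\<in>{0<..<x}. of_int a ^ 2 * of_int (x - a) ^ (n + 2)) +
        of_int x ^ (n + 2) * (\<Sum>a\<in>{0<..<x}. of_int a ^ 2 * of_int (x - a) ^ 2)"
      by (simp only: sum.distrib sum_distrib_left)
    also have "\<dots> = of_int x ^ 2 * (c1 * of_int x ^ (n + 2 + 2 + 1) + g1 x) +
        of_int x ^ 2 * (c1 * of_int x ^ (n + 2 + 2 + 1) + g1 x) + of_int x ^ (n + 2) * (c2 * of_int x ^ (2 + 2 + 1) + g2 x)"
      unfolding flip s1[OF x] s2[OF x] c1_def c2_def ..
    also have "\<dots> = r x + (2 * c1 + c2) * of_int x ^ (n + 7)"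
      unfolding r_def by (simp add: algebra_simps power_add eval_nat_numeral)
    finally show ?thesis .
  qed
  then have "lam1 (\<lambda>N x. \<Sum>a\<in>{0<..<N}. f (a, N - a)) = lam1 (\<lambda>N x. r N + (2 * c1 + c2) * of_int N ^ (n + 7))"
    by (intro lam1_cong)
  also have "\<dots> = lam1 (\<lambda>N x. r N) + fps_const (2 * c1 + c2) * lam1 (\<lambda>N x. of_int N ^ (n + 7))"
    by (rule lam1_add)
  finally have "fps_const (2 * c1 + c2) * lam1 (\<lambda>N x. of_int N ^ (n + 7)) =
      lam2 (\<lambda>a b x y. f (a, b) - f (a, - b)) - lam1 (\<lambda>N x. r N)"
    unfolding rel by simp
  moreover have "lam1 (\<lambda>N x. r N) \<in> quasi_modular"
    by (rule quasi_modular_lam1_pspan[OF r]) (use IH in auto)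
  ultimately have "fps_const (2 * c1 + c2) * lam1 (\<lambda>N x. of_int N ^ (n + 7)) \<in> quasi_modular"
    using lhs quasi_modular_diff by simp
  moreover have "2 * c1 + c2 \<noteq> 0"
  proof -
    define t where "t = real n"
    have "t \<ge> 0" by (simp add: t_def)
    then have "1 / (t + 3) - 2 / (t + 4) + 1 / (t + 5) = 2 / ((t + 3) * (t + 4) * (t + 5))"
      by (simp add: divide_simps) (simp add: algebra_simps)
    with \<open>t \<ge> 0\<close> have "1 / (t + 3) - 2 / (t + 4) + 1 / (t + 5) > 0" by simp
    moreover have "c1 = of_real (1 / (t + 3) - 2 / (t + 4) + 1 / (t + 5))"
      by (simp add: c1_def t_def numeral_2_eq_2 add.commute)
    moreover have "c2 = of_real (1 / 30)"
      by (simp add: c2_def numeral_2_eq_2)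
    ultimately have "2 * c1 + c2 = of_real (2 * (1 / (t + 3) - 2 / (t + 4) + 1 / (t + 5)) + 1 / 30)"
      and "2 * (1 / (t + 3) - 2 / (t + 4) + 1 / (t + 5)) + 1 / 30 \<noteq> 0"
      by simp_all
    then show ?thesis by (simp only: of_real_eq_0_iff not_False_eq_True)
  qed
  ultimately show ?thesis by (rule quasi_modular_scale_cancel)
qed

text \<open>The exponents 1, 3, 5 belong to the three generators, and the recursion takes over at 7.
  Its case \<open>n = 0\<close> expresses the series of \<open>a ^ 7\<close> through that of
  \<open>a ^ 3\<close> and its square, which is the identity E_8 = E_4^2.\<close>

lemma quasi_modular_lam1_odd: "odd t \<Longrightarrow> lam1 (\<lambda>a x. of_int a ^ t) \<in> quasi_modular"
proof (induction t rule: less_induct)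
  case (less t)
  show ?case
  proof (cases "t < 7")
    case True
    with less.prems have "t = 1 \<or> t = 3 \<or> t = 5" by presburger
    then show ?thesis
      using quasi_modular_lam1_small[of 1] quasi_modular_lam1_small[of 2] quasi_modular_lam1_small[of 3] by auto
  next
    case False
    then obtain n where t: "t = n + 7" using le_Suc_ex[of 7 t] by (auto simp: add.commute)
    show ?thesis unfolding t
      by (rule quasi_modular_lam1_step) (use less t in auto)
  qed
qed

text \<open>The series is the image under q d/dq of the series of \<open>a ^ (n - 1)\<close>. In
  contrast to the recursion, the function \<open>f\<close> chosen here equals
  \<open>2 * a ^ n\<close> at \<open>b = - a\<close>, so the diagonal with the factor
  \<open>N - 1\<close> survives and the relation can be solved for it.\<close>

lemma quasi_modular_lam1_linear:
  assumes n: "even n" "n > 0"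
  shows "lam1 (\<lambda>a x. of_int a ^ n * of_int x) \<in> quasi_modular"
proof -
  define f :: "int \<times> int \<Rightarrow> complex" where
    "f p = of_int (fst p) ^ n + of_int (snd p) ^ n + of_int (fst p + snd p) ^ n" for p
  have f: "f \<in> bspan (\<lambda>i j. i + j = n)"
    unfolding f_def by (rule bspan_power_triple)
  have "lam2 (\<lambda>a b x y. f (a, b) - f (a, - b)) \<in> quasi_modular"
  proof -
    have "lam1 (\<lambda>a x. of_int a ^ i) \<in> quasi_modular \<and> lam1 (\<lambda>a x. of_int a ^ j) \<in> quasi_modular"
      if "i + j = n \<and> odd j" for i j
    proof -
      have "odd i" "odd j" using that n by presburger+
      then show ?thesis by (simp add: quasi_modular_lam1_odd)
    qed
    from quasi_modular_lam2_bspan[OF bspan_difference[OF f] this] show ?thesis by simp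
  qed
  moreover have "lam2 (\<lambda>a b x y. f (a, b) - f (a, - b)) =
      lam1 (\<lambda>N x. \<Sum>a\<in>{0<..<N}. f (a, N - a)) - lam1 (\<lambda>a N. of_int (N - 1) * f (a, - a))"
  proof (rule lam2_difference_relation[of "\<lambda>a b. f (a, b)"])
    fix a b :: int
    have e: "(of_int (a - b) :: complex) ^ n = of_int (b - a) ^ n"
      using n by (metis minus_diff_eq of_int_minus power_minus_even)
    show "f (a, b) = f (b, a)" unfolding f_def by (simp add: algebra_simps)
    show "f (a, - b) = f (b, - a)" using n e unfolding f_def by (simp add: algebra_simps)
    show "f (a, b - a) = f (a, - b)" using n e unfolding f_def by (simp add: algebra_simps)
  qed
  moreover obtain g where g: "g \<in> pspan (\<lambda>i. 0 < i \<and> i < n \<and> odd (i + n))"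
    and gs: "\<And>x. x > 0 \<Longrightarrow> (\<Sum>k\<in>{0<..<x}. of_int k ^ n) + of_int x ^ n / 2 = of_int x ^ Suc n / of_nat (Suc n) + g x"
    using power_sum_parity[OF n(2)] by blast
  \<comment> \<open>\<open>r\<close> collects the odd powers. The even power with coefficient -2
    comes half from the endpoint terms of the two power sums and half from the \<open>x - 1\<close>
    equal summands; it cancels against the -2 produced by \<open>N - 1\<close> on the other
    diagonal.\<close>
  define r where "r x = 2 * g x + (2 / of_nat (Suc n) + 1) * of_int x ^ Suc n" for x
  have "lam1 (\<lambda>N x. \<Sum>a\<in>{0<..<N}. f (a, N - a)) = lam1 (\<lambda>N x. r N + (- 2) * of_int N ^ n)"
  proof (rule lam1_cong)
    fix x :: int assume x: "0 < x"
    have flip: "(\<Sum>a\<in>{0<..<x}. of_int (x - a) ^ n) = (\<Sum>a\<in>{0<..<x}. of_int a ^ n :: complex)"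
      by (rule sum.reindex_bij_witness[of _ "\<lambda>a. x - a" "\<lambda>a. x - a"]) auto
    have "(\<Sum>a\<in>{0<..<x}. f (a, x - a)) = 2 * (\<Sum>a\<in>{0<..<x}. of_int a ^ n) + of_int (x - 1) * of_int x ^ n"
      using x unfolding f_def fst_conv snd_conv sum.distrib flip by simp
    also have "(\<Sum>a\<in>{0<..<x}. of_int a ^ n) = of_int x ^ Suc n / of_nat (Suc n) + g x - of_int x ^ n / 2"
      using gs[OF x] by (simp only: eq_diff_eq)
    finally show "(\<Sum>a\<in>{0<..<x}. f (a, x - a)) = r x + (- 2) * of_int x ^ n"
      unfolding r_def by (simp add: algebra_simps del: of_nat_Suc)
  qed
  moreover have "\<dots> = lam1 (\<lambda>N x. r N) + fps_const (- 2) * lam1 (\<lambda>N x. of_int N ^ n)"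
    by (rule lam1_add)
  moreover have "lam1 (\<lambda>a N. of_int (N - 1) * f (a, - a)) =
      lam1 (\<lambda>a N. 2 * (of_int a ^ n * of_int N) + (- 2) * of_int a ^ n)"
    by (rule lam1_cong) (use n in \<open>simp add: f_def algebra_simps\<close>)
  moreover have "\<dots> = fps_const 2 * lam1 (\<lambda>a N. of_int a ^ n * of_int N) + fps_const (- 2) * lam1 (\<lambda>N x. of_int N ^ n)"
    unfolding lam1_add lam1_scale ..
  ultimately have "lam1 (\<lambda>N x. r N) - fps_const 2 * lam1 (\<lambda>a N. of_int a ^ n * of_int N) \<in> quasi_modular"
    by simp
  moreover have "lam1 (\<lambda>N x. r N) \<in> quasi_modular"
  proof (rule quasi_modular_lam1_pspan)
    show "r \<in> pspan odd"
      using pspan_power[of odd "Suc n"] pspan_mono[OF g, of odd] n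
      unfolding r_def pspan_def by (intro cspan_plus cspan_scale) auto
  qed (rule quasi_modular_lam1_odd)
  ultimately have "fps_const 2 * lam1 (\<lambda>a N. of_int a ^ n * of_int N) \<in> quasi_modular"
    using quasi_modular_diff by fastforce
  then show ?thesis by (rule quasi_modular_scale_cancel) simp
qed

text \<open>By the product rule only the generators matter. For them the preceding lemma is used
  with \<open>n\<close> equal to 2, 4 and 6, which replaces Ramanujan's differential equations.
  Membership of \<open>F\<close> itself is carried through the induction because the product rule
  needs it.\<close>

lemma quasi_modular_deriv:
  assumes "F \<in> quasi_modular" shows "fps_X * fps_deriv F \<in> quasi_modular"
proof -
  have "F \<in> quasi_modular \<and> fps_X * fps_deriv F \<in> quasi_modular"
    using assms
  proof (induction rule: quasi_modular_induct)
    case (const c)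
    show ?case by (simp add: quasi_modular_const quasi_modular_zero)
  next
    case (gens j)
    have "fps_X * fps_deriv (lam1 (\<lambda>a x. of_int a ^ (2 * j - 1))) = lam1 (\<lambda>a x. of_int a ^ (2 * j) * of_int x)"
    proof -
      have "2 * j = Suc (2 * j - 1)" using gens by auto
      then have "(of_int a :: complex) ^ (2 * j) = of_int a * of_int a ^ (2 * j - 1)" for a :: int
        by (metis power_Suc)
      then show ?thesis
        unfolding lam1_deriv by (intro lam1_cong) simp
    qed
    moreover have "lam1 (\<lambda>a x. of_int a ^ (2 * j) * of_int x) \<in> quasi_modular"
      by (rule quasi_modular_lam1_linear) (use gens in auto)
    ultimately have "fps_X * fps_deriv (lam1 (\<lambda>a x. of_int a ^ (2 * j - 1))) \<in> quasi_modular" by simp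
    then have "fps_const (- (4 * of_nat j / bernoulli_number (2 * j))) *
        (fps_X * fps_deriv (lam1 (\<lambda>a x. of_int a ^ (2 * j - 1)))) \<in> quasi_modular"
      by (rule quasi_modular_scale)
    also have "fps_const (- (4 * of_nat j / bernoulli_number (2 * j))) *
        (fps_X * fps_deriv (lam1 (\<lambda>a x. of_int a ^ (2 * j - 1)))) = fps_X * fps_deriv (eisenstein j)"
      unfolding eisenstein_eq_lam1 by (simp add: mult.left_commute flip: fps_const_neg)
    finally show ?case using quasi_modular_eisenstein[OF gens] by simp
  next
    case (add F G)
    then show ?case by (simp add: distrib_left quasi_modular_add)
  next
    case (mult F G)
    have "fps_X * fps_deriv (F * G) = F * (fps_X * fps_deriv G) + (fps_X * fps_deriv F) * G"
      by (simp add: algebra_simps)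
    with mult show ?case by (simp add: quasi_modular_add quasi_modular_mult)
  qed
  then show ?thesis by blast
qed

text \<open>Applying q d/dq multiplies the coefficient by \<open>a * x\<close> and so raises both
  exponents by one. Start from the odd power \<open>t - i\<close> of \<open>a\<close> alone; if
  \<open>i\<close> exceeds \<open>t\<close>, exchange \<open>a\<close> and \<open>x\<close>.\<close>

lemma quasi_modular_lam1_monomial:
  assumes "odd (t + i)"
  shows "lam1 (\<lambda>a x. of_int a ^ t * of_int x ^ i) \<in> quasi_modular"
proof -
  have *: "lam1 (\<lambda>a x. of_int a ^ (m + i) * of_int x ^ i) \<in> quasi_modular" if "odd m" for m i
  proof (induction i)
    case 0
    then show ?case using quasi_modular_lam1_odd[OF that] by simp
  next
    case (Suc i)
    have "fps_X * fps_deriv (lam1 (\<lambda>a x. of_int a ^ (m + i) * of_int x ^ i)) =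
        lam1 (\<lambda>a x. of_int a ^ (m + Suc i) * of_int x ^ Suc i)"
      unfolding lam1_deriv by (rule lam1_cong) simp
    with quasi_modular_deriv[OF Suc] show ?case by simp
  qed
  show ?thesis
  proof (cases "i \<le> t")
    case True
    then show ?thesis using *[of "t - i" i] assms by simp
  next
    case False
    then have "lam1 (\<lambda>a x. of_int a ^ i * of_int x ^ t) \<in> quasi_modular"
      using *[of "i - t" t] assms by simp
    then show ?thesis by (subst lam1_swap) (simp add: mult.commute)
  qed
qed


subsection \<open>Truncated convolutions\<close>

text \<open>This is V of the overview. Only the first argument bounds the summation, so the second
  may be any integer and is later taken to be \<open>- x\<close>.\<close>

definition tconv :: "(int \<Rightarrow> complex) \<Rightarrow> int \<Rightarrow> int \<Rightarrow> complex" where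
  "tconv g x y = (\<Sum>n\<in>{0<..<x}. g n * g (x - n) * g (y - n))"

lemma pspan_odd_minus: "g \<in> pspan odd \<Longrightarrow> g (- x) = - g x"
  unfolding pspan_def by (induction rule: cspan.induct) auto

text \<open>Expand \<open>(y - n) ^ t\<close> in powers of \<open>n\<close>. The convolution of
  exponents \<open>p + i\<close> and \<open>r\<close>, both positive since \<open>p\<close> and
  \<open>r\<close> are odd, has parity \<open>p + i + r + 1\<close> in \<open>x\<close> and is
  multiplied by \<open>y ^ (t - i)\<close>; the total degree has the parity of
  \<open>p + r + t + 1\<close>, which is even.\<close>

lemma power_triple_convolution:
  assumes "odd p" "odd r" "odd t"
  shows "\<exists>W\<in>bspan (\<lambda>i j. even (i + j)). \<forall>x>0. \<forall>y.
    (\<Sum>n\<in>{0<..<x}. of_int n ^ p * of_int (x - n) ^ r * of_int (y - n) ^ t) = W (x, y)"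
proof -
  have "\<exists>B. B \<in> pspan (\<lambda>k. odd (k + (p + i) + r)) \<and>
    (\<forall>x>0. (\<Sum>n\<in>{0<..<x}. of_int n ^ (p + i) * of_int (x - n) ^ r) = B x)" for i
  proof -
    have pos: "p + i > 0" "r > 0" using assms by (auto intro: Nat.gr0I)
    obtain g where g: "g \<in> pspan (\<lambda>k. k < p + i + r + 1 \<and> odd (k + (p + i) + r))"
      and s: "\<And>x. x > 0 \<Longrightarrow> (\<Sum>n\<in>{0<..<x}. of_int n ^ (p + i) * of_int (x - n) ^ r) =
        (\<Sum>j\<le>r. of_nat (r choose j) * (-1) ^ j / of_nat (p + i + j + 1)) * of_int x ^ (p + i + r + 1) + g x"
      using power_convolution_parity[OF pos] by blast
    let ?C = "\<Sum>j\<le>r. of_nat (r choose j) * (-1) ^ j / of_nat (p + i + j + 1) :: complex"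
    have "(\<lambda>x. g x + ?C * of_int x ^ (p + i + r + 1)) \<in> pspan (\<lambda>k. odd (k + (p + i) + r))"
      using pspan_power[of "\<lambda>k. odd (k + (p + i) + r)" "p + i + r + 1"]
        pspan_mono[OF g, of "\<lambda>k. odd (k + (p + i) + r)"]
      unfolding pspan_def by (intro cspan_add_scaled) auto
    with s show ?thesis by (intro exI[of _ "\<lambda>x. g x + ?C * of_int x ^ (p + i + r + 1)"]) (simp add: add.commute)
  qed
  then have "\<forall>i. \<exists>B. B \<in> pspan (\<lambda>k. odd (k + (p + i) + r)) \<and>
    (\<forall>x>0. (\<Sum>n\<in>{0<..<x}. of_int n ^ (p + i) * of_int (x - n) ^ r) = B x)" by blast
  from choice[OF this] obtain B where B: "\<And>i. B i \<in> pspan (\<lambda>k. odd (k + (p + i) + r))"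
    and Bs: "\<And>i x. x > 0 \<Longrightarrow> (\<Sum>n\<in>{0<..<x}. of_int n ^ (p + i) * of_int (x - n) ^ r) = B i x"
    by blast
  define W :: "int \<times> int \<Rightarrow> complex" where
    "W q = (\<Sum>i\<le>t. (of_nat (t choose i) * (-1) ^ i) * (B i (fst q) * of_int (snd q) ^ (t - i)))" for q
  have "(\<lambda>q. B i (fst q) * of_int (snd q) ^ (t - i)) \<in> bspan (\<lambda>i j. even (i + j))" if "i \<le> t" for i
    by (rule bspan_tensor[OF B pspan_power[of "\<lambda>k. k = t - i" "t - i"]]) (use assms that in auto)
  then have "W \<in> bspan (\<lambda>i j. even (i + j))"
    unfolding W_def bspan_def by (intro cspan_sum cspan_scale) auto
  moreover have "(\<Sum>n\<in>{0<..<x}. of_int n ^ p * of_int (x - n) ^ r * of_int (y - n) ^ t) = W (x, y)"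
    if x: "x > 0" for x y
  proof -
    have e1: "(of_int (y - n) :: complex) ^ t = (\<Sum>i\<le>t. of_nat (t choose i) * (- of_int n) ^ i * of_int y ^ (t - i))" for n
      using binomial_ring[of "- of_int n :: complex" "of_int y" t] by simp
    have e2: "of_int n ^ p * of_int (x - n) ^ r * (of_nat (t choose i) * (- of_int n) ^ i * of_int y ^ (t - i)) =
        (of_nat (t choose i) * (-1) ^ i) * (of_int n ^ (p + i) * of_int (x - n) ^ r * of_int y ^ (t - i) :: complex)" for n i
      unfolding power_minus[of "of_int n" i] power_add by (simp only: mult_ac)
    show ?thesis
      unfolding e1 sum_distrib_left e2
      by (subst sum.swap) (simp add: W_def Bs[OF x, symmetric] sum_distrib_left sum_distrib_right)
  qed
  ultimately show ?thesis by blast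
qed

text \<open>Agreement is required only for \<open>x > 0\<close>, since for other \<open>x\<close>
  the convolution is an empty sum, but for every \<open>y\<close>, since negative second arguments
  are used.\<close>

definition bpoly_even :: "(int \<Rightarrow> int \<Rightarrow> complex) \<Rightarrow> bool" where
  "bpoly_even F \<longleftrightarrow> (\<exists>W\<in>bspan (\<lambda>i j. even (i + j)). \<forall>x>0. \<forall>y. F x y = W (x, y))"

lemma bpoly_even_zero: "bpoly_even (\<lambda>x y. 0)"
  unfolding bpoly_even_def bspan_def by (rule bexI[OF _ cspan.zero]) simp

lemma bpoly_even_add:
  assumes "bpoly_even F" "bpoly_even G" shows "bpoly_even (\<lambda>x y. F x y + c * G x y)"
proof -
  from assms obtain V W where V: "V \<in> bspan (\<lambda>i j. even (i + j))" "\<forall>x>0. \<forall>y. F x y = V (x, y)"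
    and W: "W \<in> bspan (\<lambda>i j. even (i + j))" "\<forall>x>0. \<forall>y. G x y = W (x, y)"
    unfolding bpoly_even_def by blast
  have "(\<lambda>q. V q + c * W q) \<in> bspan (\<lambda>i j. even (i + j))"
    using V(1) W(1) unfolding bspan_def by (rule cspan_add_scaled[rotated])
  with V(2) W(2) show ?thesis
    unfolding bpoly_even_def by (intro bexI[of _ "\<lambda>q. V q + c * W q"]) auto
qed

lemma bpoly_even_triple:
  assumes "g1 \<in> pspan odd" "g2 \<in> pspan odd" "g3 \<in> pspan odd"
  shows "bpoly_even (\<lambda>x y. \<Sum>n\<in>{0<..<x}. g1 n * g2 (x - n) * g3 (y - n))"
proof -
  let ?M = "{(\<lambda>x :: int. of_int x ^ i :: complex) | i. odd i}"
  have 1: "bpoly_even (\<lambda>x y. \<Sum>n\<in>{0<..<x}. f n * g (x - n) * h (y - n))"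
    if "f \<in> cspan ?M" "g \<in> ?M" "h \<in> ?M" for f g h
    using that(1)
  proof (induction rule: cspan.induct)
    case zero
    show ?case by (simp add: bpoly_even_zero)
  next
    case (add f u c)
    have "bpoly_even (\<lambda>x y. \<Sum>n\<in>{0<..<x}. u n * g (x - n) * h (y - n))"
      using add.hyps(2) that(2,3) power_triple_convolution unfolding bpoly_even_def by fastforce
    from bpoly_even_add[OF add.IH this, of c] show ?case
      by (simp add: sum.distrib sum_distrib_left algebra_simps)
  qed
  have 2: "bpoly_even (\<lambda>x y. \<Sum>n\<in>{0<..<x}. f n * g (x - n) * h (y - n))"
    if "f \<in> cspan ?M" "g \<in> cspan ?M" "h \<in> ?M" for f g h
    using that(2)
  proof (induction rule: cspan.induct)
    case zero
    show ?case by (simp add: bpoly_even_zero)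
  next
    case (add g u c)
    from bpoly_even_add[OF add.IH 1[OF that(1) add.hyps(2) that(3)], of c] show ?case
      by (simp add: sum.distrib sum_distrib_left algebra_simps)
  qed
  have "bpoly_even (\<lambda>x y. \<Sum>n\<in>{0<..<x}. f n * g (x - n) * h (y - n))"
    if "f \<in> cspan ?M" "g \<in> cspan ?M" "h \<in> cspan ?M" for f g h
    using that(3)
  proof (induction rule: cspan.induct)
    case zero
    show ?case by (simp add: bpoly_even_zero)
  next
    case (add h u c)
    from bpoly_even_add[OF add.IH 2[OF that(1,2) add.hyps(2)], of c] show ?case
      by (simp add: sum.distrib sum_distrib_left algebra_simps)
  qed
  with assms show ?thesis unfolding pspan_def by blast
qed

text \<open>Replace \<open>n\<close> by \<open>y - n\<close> and use oddness in the third factor.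
  The left-hand side is what the shear makes of \<open>tconv g y x\<close>.\<close>

lemma tconv_reflect_snd: "tconv g y (x + y) = - tconv g y (- x)"
  if "\<And>x. g (- x) = - g x"
proof -
  have "tconv g y (x + y) = (\<Sum>n\<in>{0<..<y}. g (y - n) * g n * g (x + n))"
    unfolding tconv_def
    by (rule sum.reindex_bij_witness[of _ "\<lambda>n. y - n" "\<lambda>n. y - n"]) (auto simp: algebra_simps)
  also have "\<dots> = (\<Sum>n\<in>{0<..<y}. - (g n * g (y - n) * g (- x - n)))"
  proof (rule sum.cong)
    fix n
    have "g (x + n) = - g (- x - n)" using that[of "x + n"] by simp
    then show "g (y - n) * g n * g (x + n) = - (g n * g (y - n) * g (- x - n))" by simp
  qed simp
  finally show ?thesis by (simp add: tconv_def sum_negf)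
qed

text \<open>Cut the sum at \<open>n = y\<close>, where \<open>g 0 = 0\<close>. The lower part is
  covered by the preceding lemma; the upper part is reflected into a sum over
  \<open>0 < n < x\<close>, with two sign changes. The left-hand side is what the shear makes of
  \<open>tconv g x y\<close>.\<close>

lemma tconv_split: "tconv g (x + y) y = tconv g x (- y) - tconv g y (- x)"
  if "\<And>x. g (- x) = - g x" and "0 < x" "0 < y"
proof -
  let ?f = "\<lambda>n. g n * g (x + y - n) * g (y - n)"
  have "{0<..<x + y} = {0<..<y} \<union> {y} \<union> {y<..<x + y}" using that by auto
  then have "tconv g (x + y) y = sum ?f ({0<..<y} \<union> {y} \<union> {y<..<x + y})"
    by (simp only: tconv_def)
  also have "\<dots> = sum ?f {0<..<y} + sum ?f {y} + sum ?f {y<..<x + y}"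
    by (subst sum.union_disjoint; (subst sum.union_disjoint)?) auto
  also have "sum ?f {0<..<y} = tconv g y (x + y)"
    unfolding tconv_def by (intro sum.cong) auto
  also have "sum ?f {y} = 0" using that(1)[of 0] by simp
  also have "sum ?f {y<..<x + y} = (\<Sum>n\<in>{0<..<x}. g n * g (x - n) * g (- y - n))"
  proof -
    have "sum ?f {y<..<x + y} = (\<Sum>n\<in>{0<..<x}. g (x + y - n) * g n * g (n - x))"
      by (rule sum.reindex_bij_witness[of _ "\<lambda>n. x + y - n" "\<lambda>n. x + y - n"]) (auto simp: algebra_simps)
    also have "\<dots> = (\<Sum>n\<in>{0<..<x}. g n * g (x - n) * g (- y - (x - n)))"
    proof (rule sum.cong)
      fix n
      have "g (n - x) = - g (x - n)" "g (- y - (x - n)) = - g (x + y - n)"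
        using that(1)[of "x - n"] that(1)[of "x + y - n"] by (simp_all add: algebra_simps)
      then show "g (x + y - n) * g n * g (n - x) = g n * g (x - n) * g (- y - (x - n))" by simp
    qed simp
    also have "\<dots> = (\<Sum>n\<in>{0<..<x}. g n * g (x - n) * g (- y - n))"
      by (rule sum.reindex_bij_witness[of _ "\<lambda>n. x - n" "\<lambda>n. x - n"]) (auto simp: algebra_simps)
    finally show ?thesis .
  qed
  finally show ?thesis
    using tconv_reflect_snd[of g y x, OF that(1)] by (simp add: tconv_def)
qed

text \<open>
  The part \<open>x \<noteq> y\<close> of the left-hand side is twice a sum over \<open>y < x\<close>; the shear turns it and the
  corresponding parts of the right-hand side into sums over \<open>a < b\<close>.
\<close>

lemma lam2_tconv_relation:
  fixes K :: "int \<Rightarrow> int \<Rightarrow> complex"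
  assumes g: "\<And>x. g (- x) = - g x"
    and sym: "\<And>a b. K a b = K b a" and even: "\<And>a b. K a (- b) = K b (- a)"
    and shear: "\<And>a b. K a (b - a) = K a (- b)" and diag: "\<And>a. K a (- a) = 0"
  shows "3 * lam2 (\<lambda>a b x y. K a b * tconv g (min x y) (max x y)) =
    2 * lam2 (\<lambda>a b x y. K a b * tconv g y x - K a (- b) * tconv g y (- x)) +
    lam1 (\<lambda>N x. (\<Sum>a\<in>{0<..<N}. K a (N - a)) * tconv g x x)"
proof -
  \<comment> \<open>\<open>?P\<close> and \<open>?Q\<close> are the two kinds of half-range sum. The
    wanted sum is \<open>2 P + D\<close>. In the full-range difference \<open>Q\<close> cancels:
    \<open>(2 P - Q + D) + (P + Q) = 3 P + D\<close>. Hence the coefficients in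
    \<open>3 (2 P + D) = 2 (3 P + D) + D\<close>.\<close>
  let ?P = "lam2 (\<lambda>a b x y. if a < b then - (K a (- b) * tconv g y (- x)) else 0)"
  let ?Q = "lam2 (\<lambda>a b x y. if a < b then - (K a (- b) * tconv g x (- y)) else 0)"
  let ?D = "lam2 (\<lambda>a b x y. if x = y then K a b * tconv g x x else 0)"
  have lt: "lam2 (\<lambda>a b x y. if y < x then K a b * tconv g y x else 0) = ?P"
    unfolding lam2_shear[of "\<lambda>a b x y. K a b * tconv g y x"]
    by (rule lam2_cong) (simp add: shear tconv_reflect_snd[of g, OF g])
  have lt': "lam2 (\<lambda>a b x y. if x < y then K a b * tconv g x y else 0) = ?P"
    unfolding lt[symmetric] by (subst lam2_swap, rule lam2_cong) (simp add: sym)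
  have gt: "lam2 (\<lambda>a b x y. if y < x then K a b * tconv g x y else 0) = ?P - ?Q"
    unfolding lam2_shear[of "\<lambda>a b x y. K a b * tconv g x y"] lam2_minus[symmetric]
    by (rule lam2_cong) (simp add: shear tconv_split[of g, OF g] algebra_simps)
  have gt': "lam2 (\<lambda>a b x y. if x < y then K a b * tconv g y x else 0) = ?P - ?Q"
    unfolding gt[symmetric] by (subst lam2_swap, rule lam2_cong) (simp add: sym)
  have Q: "lam2 (\<lambda>a b x y. if b < a then - (K a (- b) * tconv g y (- x)) else 0) = ?Q"
    by (subst lam2_swap, rule lam2_cong) (simp add: even)
  have "lam2 (\<lambda>a b x y. K a b * tconv g (min x y) (max x y)) =
      lam2 (\<lambda>a b x y. if y < x then K a b * tconv g y x else 0) +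
      lam2 (\<lambda>a b x y. if x < y then K a b * tconv g x y else 0) + ?D"
    by (subst lam2_split) (intro arg_cong2[of _ _ _ _ "(+)"] lam2_cong; simp)
  then have U: "lam2 (\<lambda>a b x y. K a b * tconv g (min x y) (max x y)) = ?P + ?P + ?D"
    by (simp only: lt lt')
  have "lam2 (\<lambda>a b x y. K a b * tconv g y x) =
      lam2 (\<lambda>a b x y. if y < x then K a b * tconv g y x else 0) +
      lam2 (\<lambda>a b x y. if x < y then K a b * tconv g y x else 0) + ?D"
    by (subst lam2_split) (intro arg_cong2[of _ _ _ _ "(+)"] lam2_cong; simp)
  then have V: "lam2 (\<lambda>a b x y. K a b * tconv g y x) = ?P + (?P - ?Q) + ?D"
    by (simp only: lt gt')
  have "lam2 (\<lambda>a b x y. - (K a (- b) * tconv g y (- x))) = ?P + ?Q +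
      lam2 (\<lambda>a b x y. if a = b then - (K a (- b) * tconv g y (- x)) else 0)"
    by (subst lam2_split') (simp only: Q)
  also have "lam2 (\<lambda>a b x y. if a = b then - (K a (- b) * tconv g y (- x)) else 0) = lam2 (\<lambda>a b x y. 0)"
    by (rule lam2_cong) (simp add: diag)
  finally have R: "lam2 (\<lambda>a b x y. - (K a (- b) * tconv g y (- x))) = ?P + ?Q" by simp
  have "lam2 (\<lambda>a b x y. K a b * tconv g y x - K a (- b) * tconv g y (- x)) = ?P + (?P - ?Q) + ?D + (?P + ?Q)"
    unfolding V[symmetric] R[symmetric] lam2_plus[symmetric] by simp
  moreover have "?D = lam1 (\<lambda>N x. (\<Sum>a\<in>{0<..<N}. K a (N - a)) * tconv g x x)"
    unfolding lam2_diagonal[of "\<lambda>a b x. K a b * tconv g x x"] by (simp add: sum_distrib_right)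
  ultimately show ?thesis unfolding U by (simp add: algebra_simps)
qed

section \<open>Membership of the polynomial Lambert sums in the ring\<close>

lemma quasi_modular_lam1_tensor:
  assumes "f \<in> pspan odd" "h \<in> pspan even"
  shows "lam1 (\<lambda>a x. f a * h x) \<in> quasi_modular"
  using assms(1) unfolding pspan_def
proof (induction rule: cspan.induct)
  case zero
  show ?case by (simp add: quasi_modular_zero)
next
  case (add f u c)
  then obtain t where t: "odd t" "u = (\<lambda>x. of_int x ^ t)" by auto
  have "lam1 (\<lambda>a x. u a * h x) \<in> quasi_modular"
    using assms(2) unfolding pspan_def
  proof (induction rule: cspan.induct)
    case zero
    show ?case by (simp add: quasi_modular_zero)
  next
    case (add h v d)
    then obtain i where i: "even i" "v = (\<lambda>x. of_int x ^ i)" by auto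
    have "lam1 (\<lambda>a x. u a * h x) + fps_const d * lam1 (\<lambda>a x. u a * v x) \<in> quasi_modular"
      using add.IH t i by (intro quasi_modular_add quasi_modular_scale) (auto intro: quasi_modular_lam1_monomial)
    then show ?case unfolding lam1_add[symmetric] by (simp add: algebra_simps)
  qed
  with add.IH have "lam1 (\<lambda>a x. f a * h x) + fps_const c * lam1 (\<lambda>a x. u a * h x) \<in> quasi_modular"
    by (intro quasi_modular_add quasi_modular_scale)
  then show ?case unfolding lam1_add[symmetric] by (simp add: algebra_simps)
qed

text \<open>Changing the signs of \<open>b\<close> and \<open>x\<close> together multiplies a
  monomial by \<open>(-1) ^ (j + r)\<close>, so only odd \<open>j + r\<close> contributes. As
  \<open>i + j\<close> and \<open>p + r\<close> are even, \<open>i + r\<close> and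
  \<open>j + p\<close> are then odd too, and these are the total degrees of the two factors, in
  \<open>(a, x)\<close> and in \<open>(b, y)\<close>.\<close>

lemma quasi_modular_lam2_tensor:
  assumes "K \<in> bspan (\<lambda>i j. even (i + j))" "W \<in> bspan (\<lambda>i j. even (i + j))"
  shows "lam2 (\<lambda>a b x y. K (a, b) * W (y, x) - K (a, - b) * W (y, - x)) \<in> quasi_modular"
  using assms(1) unfolding bspan_def
proof (induction rule: cspan.induct)
  case zero
  show ?case by (simp add: quasi_modular_zero)
next
  case (add K u c)
  then obtain i j where ij: "even (i + j)" "u = (\<lambda>p. of_int (fst p) ^ i * of_int (snd p) ^ j)" by auto
  have "lam2 (\<lambda>a b x y. u (a, b) * W (y, x) - u (a, - b) * W (y, - x)) \<in> quasi_modular"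
    using assms(2) unfolding bspan_def
  proof (induction rule: cspan.induct)
    case zero
    show ?case by (simp add: quasi_modular_zero)
  next
    case (add W v d)
    then obtain p r where pr: "even (p + r)" "v = (\<lambda>q. of_int (fst q) ^ p * of_int (snd q) ^ r)" by auto
    have "lam2 (\<lambda>a b x y. u (a, b) * v (y, x) - u (a, - b) * v (y, - x)) \<in> quasi_modular"
    proof (cases "even (j + r)")
      case True
      then have "lam2 (\<lambda>a b x y. u (a, b) * v (y, x) - u (a, - b) * v (y, - x)) = lam2 (\<lambda>a b x y. 0)"
        unfolding ij pr by (intro lam2_cong) (auto simp: power_minus_odd)
      then show ?thesis by (simp add: quasi_modular_zero)
    next
      case False
      then have "lam2 (\<lambda>a b x y. u (a, b) * v (y, x) - u (a, - b) * v (y, - x)) =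
          lam2 (\<lambda>a b x y. 2 * ((of_int a ^ i * of_int x ^ r) * (of_int b ^ j * of_int y ^ p)))"
        unfolding ij pr by (intro lam2_cong) (auto simp: power_minus_odd)
      also have "\<dots> = fps_const 2 * (lam1 (\<lambda>a x. of_int a ^ i * of_int x ^ r) * lam1 (\<lambda>a x. of_int a ^ j * of_int x ^ p))"
        unfolding lam2_scale lam2_product ..
      also have "\<dots> \<in> quasi_modular"
        using ij(1) pr(1) False
        by (intro quasi_modular_scale quasi_modular_mult quasi_modular_lam1_monomial) auto
      finally show ?thesis .
    qed
    with add.IH have "lam2 (\<lambda>a b x y. u (a, b) * W (y, x) - u (a, - b) * W (y, - x)) +
        fps_const d * lam2 (\<lambda>a b x y. u (a, b) * v (y, x) - u (a, - b) * v (y, - x)) \<in> quasi_modular"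
      by (intro quasi_modular_add quasi_modular_scale)
    then show ?case unfolding lam2_add[symmetric] by (simp add: algebra_simps)
  qed
  with add.IH have "lam2 (\<lambda>a b x y. K (a, b) * W (y, x) - K (a, - b) * W (y, - x)) +
      fps_const c * lam2 (\<lambda>a b x y. u (a, b) * W (y, x) - u (a, - b) * W (y, - x)) \<in> quasi_modular"
    by (intro quasi_modular_add quasi_modular_scale)
  then show ?case unfolding lam2_add[symmetric] by (simp add: algebra_simps)
qed

lemma bspan_diagonal:
  assumes "f \<in> bspan P" "\<And>i j. P i j \<Longrightarrow> Q (i + j)" shows "(\<lambda>x. f (x, x)) \<in> pspan Q"
  using assms(1) unfolding bspan_def pspan_def
  by (induction rule: cspan.induct) (auto intro!: cspan.intros assms(2) simp flip: power_add)

text \<open>With min and max the coefficient is not a polynomial. The relation trades it for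
  \<open>tconv g y x\<close> and \<open>tconv g y (- x)\<close>, which agree with one polynomial
  \<open>W\<close> whatever the order of \<open>x\<close> and \<open>y\<close>.\<close>

lemma quasi_modular_lam2_tconv:
  assumes g: "g \<in> pspan odd" and s: "even s" "s > 0"
  shows "lam2 (\<lambda>a b x y. of_int (a * b * (a + b)) ^ s * tconv g (min x y) (max x y)) \<in> quasi_modular"
proof -
  define K :: "int \<times> int \<Rightarrow> complex" where "K p = of_int (fst p) ^ s * of_int (snd p) ^ s * of_int (fst p + snd p) ^ s" for p
  have K: "K \<in> bspan (\<lambda>i j. even (i + j))"
    unfolding K_def
    by (rule bspan_mult[OF bspan_power[of "\<lambda>i j. i = s \<and> j = s"] bspan_sum_power]) (use s in auto)
  obtain W where W: "W \<in> bspan (\<lambda>i j. even (i + j))" "\<And>x y. x > 0 \<Longrightarrow> tconv g x y = W (x, y)"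
    using bpoly_even_triple[OF g g g] unfolding bpoly_even_def tconv_def by blast
  have "lam2 (\<lambda>a b x y. of_int (a * b * (a + b)) ^ s * tconv g (min x y) (max x y)) =
      lam2 (\<lambda>a b x y. K (a, b) * tconv g (min x y) (max x y))"
    by (simp add: K_def power_mult_distrib)
  moreover have "3 * lam2 (\<lambda>a b x y. K (a, b) * tconv g (min x y) (max x y)) =
      2 * lam2 (\<lambda>a b x y. K (a, b) * tconv g y x - K (a, - b) * tconv g y (- x)) +
      lam1 (\<lambda>N x. (\<Sum>a\<in>{0<..<N}. K (a, N - a)) * tconv g x x)"
  proof (rule lam2_tconv_relation[of g "\<lambda>a b. K (a, b)"])
    show "g (- x) = - g x" for x using g by (rule pspan_odd_minus)
    fix a b :: int
    have e: "(of_int (a - b) :: complex) ^ s = of_int (b - a) ^ s"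
      using s by (metis minus_diff_eq of_int_minus power_minus_even)
    show "K (a, b) = K (b, a)" unfolding K_def by (simp add: algebra_simps)
    show "K (a, - b) = K (b, - a)" using s e unfolding K_def by (simp add: algebra_simps)
    show "K (a, b - a) = K (a, - b)" using s e unfolding K_def by (simp add: algebra_simps)
    show "K (a, - a) = 0" using s unfolding K_def by simp
  qed
  moreover have "lam2 (\<lambda>a b x y. K (a, b) * tconv g y x - K (a, - b) * tconv g y (- x)) \<in> quasi_modular"
    using quasi_modular_lam2_tensor[OF K W(1)] by (simp add: W(2) cong: lam2_cong)
  moreover have "lam1 (\<lambda>N x. (\<Sum>a\<in>{0<..<N}. K (a, N - a)) * tconv g x x) \<in> quasi_modular"
  proof -
    obtain B C where B: "B \<in> pspan (\<lambda>i. i < s + s + 1 \<and> odd (i + s + s))"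
      and Bs: "\<And>x. x > 0 \<Longrightarrow> (\<Sum>n\<in>{0<..<x}. of_int n ^ s * of_int (x - n) ^ s) = C * of_int x ^ (s + s + 1) + B x"
      using power_convolution_parity[OF s(2) s(2)] by blast
    \<comment> \<open>The diagonal sum separates: an odd polynomial in \<open>N\<close>, because the
      convolution of two equal even powers is odd, times the even polynomial
      \<open>W (x, x)\<close>.\<close>
    define f where "f x = of_int x ^ s * (B x + C * of_int x ^ (s + s + 1))" for x
    have "(\<lambda>x. B x + C * of_int x ^ (s + s + 1)) \<in> pspan odd"
      using pspan_power[of odd "s + s + 1"] pspan_mono[OF B, of odd] s
      unfolding pspan_def by (intro cspan_add_scaled) auto
    then have f: "f \<in> pspan odd"
      unfolding f_def by (rule pspan_mult[OF pspan_power[of even s, OF s(1)]]) auto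
    have "lam1 (\<lambda>N x. (\<Sum>a\<in>{0<..<N}. K (a, N - a)) * tconv g x x) = lam1 (\<lambda>N x. f N * W (x, x))"
    proof (rule lam1_cong)
      fix N x :: int assume "0 < N" "0 < x"
      have "(\<Sum>a\<in>{0<..<N}. K (a, N - a)) = of_int N ^ s * (\<Sum>n\<in>{0<..<N}. of_int n ^ s * of_int (N - n) ^ s)"
        unfolding sum_distrib_left K_def by (intro sum.cong) simp_all
      then have "(\<Sum>a\<in>{0<..<N}. K (a, N - a)) = f N"
        unfolding Bs[OF \<open>0 < N\<close>] f_def by (simp only: add.commute)
      then show "(\<Sum>a\<in>{0<..<N}. K (a, N - a)) * tconv g x x = f N * W (x, x)"
        using W(2)[OF \<open>0 < x\<close>] by simp
    qed
    then show ?thesis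
      using quasi_modular_lam1_tensor[OF f bspan_diagonal[OF W(1), of even]] by simp
  qed
  ultimately have "3 * lam2 (\<lambda>a b x y. of_int (a * b * (a + b)) ^ s * tconv g (min x y) (max x y)) \<in> quasi_modular"
    using quasi_modular_scale[of _ 2] by (auto simp: numeral_fps_const intro: quasi_modular_add)
  then show ?thesis
    using quasi_modular_scale_cancel[of 3] by (simp add: numeral_fps_const)
qed

subsection \<open>Expansion of the q-zeta function\<close>

text \<open>For \<open>k > 0\<close> this is the polynomial \<open>binom (x + k - 1, 2 k - 1)\<close>, factored to exhibit its parity.\<close>

definition odd_binomial :: "nat \<Rightarrow> int \<Rightarrow> complex" where
  "odd_binomial k x = of_int x * (\<Prod>i\<in>{1..<k}. of_int x ^ 2 - of_nat i ^ 2) / fact (2 * k - 1)"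

lemma odd_binomial_pspan: "odd_binomial k \<in> pspan odd"
proof -
  have "(\<lambda>x. \<Prod>i\<in>{1..<k}. of_int x ^ 2 - of_nat i ^ 2) \<in> pspan even"
  proof (induction k)
    case 0
    then show ?case using pspan_power[of even 0] by simp
  next
    case (Suc k)
    have "(\<lambda>x. of_int x ^ 2 + (- (of_nat k ^ 2)) * of_int x ^ 0) \<in> pspan even"
      using pspan_power[of even 2] pspan_power[of even 0] unfolding pspan_def
      by (intro cspan_add_scaled) auto
    from pspan_mult[OF Suc this, of even] show ?case
      by (cases "k = 0") (use Suc in \<open>auto simp: atLeastLessThanSuc mult.commute\<close>)
  qed
  from pspan_mult[OF pspan_power[of odd 1] this, of odd]
  have "(\<lambda>x. (1 / fact (2 * k - 1)) * (of_int x ^ 1 * (\<Prod>i\<in>{1..<k}. of_int x ^ 2 - of_nat i ^ 2))) \<in> pspan odd"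
    unfolding pspan_def by (intro cspan_scale) auto
  moreover have "odd_binomial k = (\<lambda>x. (1 / fact (2 * k - 1)) * (of_int x ^ 1 * (\<Prod>i\<in>{1..<k}. of_int x ^ 2 - of_nat i ^ 2)))"
    by (simp add: odd_binomial_def fun_eq_iff)
  ultimately show ?thesis by simp
qed

text \<open>Passing from \<open>k\<close> to \<open>k + 1\<close> contributes n^2 - (k+1)^2 = (n + k
  + 1)(n - k - 1), and these are the two factors by which absorption raises both entries of the
  binomial coefficient. For \<open>n < Suc k\<close> both sides of the step vanish.\<close>

lemma odd_binomial_eq: "odd_binomial (Suc k) (int n) = of_nat ((n + k) choose (2 * k + 1))"
proof (induction k)
  case 0
  then show ?case by (simp add: odd_binomial_def)
next
  case (Suc k)
  have f: "(fact (2 * Suc (Suc k) - 1) :: complex) = of_nat (2 * k + 3) * of_nat (2 * k + 2) * fact (2 * Suc k - 1)"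
    by (simp add: numeral_eq_Suc algebra_simps)
  have "{1..<Suc (Suc k)} = insert (Suc k) {1..<Suc k}" by auto
  then have "of_nat (2 * k + 3) * of_nat (2 * k + 2) * odd_binomial (Suc (Suc k)) (int n) =
      odd_binomial (Suc k) (int n) * (of_nat n ^ 2 - of_nat (Suc k) ^ 2)"
    unfolding odd_binomial_def f by (simp del: of_nat_Suc of_nat_add of_nat_mult fact_Suc)
  also have "\<dots> = of_nat ((n + k) choose (2 * k + 1)) * (of_nat n ^ 2 - of_nat (Suc k) ^ 2)"
    by (simp only: Suc.IH)
  also have "\<dots> = of_nat (2 * k + 3) * of_nat (2 * k + 2) * of_nat ((n + Suc k) choose (2 * Suc k + 1))"
  proof (cases "n < Suc k")
    case True
    then show ?thesis by (simp add: binomial_eq_0)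
  next
    case False
    then obtain d where d: "n = Suc k + d" using le_Suc_ex by (metis not_less)
    have "(2 * k + 3) * (2 * k + 2) * ((n + Suc k) choose (2 * k + 3)) =
        (2 * k + 2) * (Suc (2 * k + 2) * (Suc (n + k) choose Suc (2 * k + 2)))"
    proof -
      have "2 * k + 3 = Suc (2 * k + 2)" "n + Suc k = Suc (n + k)" by simp_all
      then show ?thesis by (simp only: mult_ac)
    qed
    also have "\<dots> = (n + Suc k) * (Suc (2 * k + 1) * ((n + k) choose Suc (2 * k + 1)))"
      unfolding Suc_times_binomial by (simp add: algebra_simps)
    also have "Suc (2 * k + 1) * ((n + k) choose Suc (2 * k + 1)) = ((n + k) - (2 * k + 1)) * ((n + k) choose (2 * k + 1))"
      by (simp only: binomial_absorption binomial_absorb_comp)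
    also have "(n + k) - (2 * k + 1) = d" using d by simp
    finally have "(2 * k + 3) * (2 * k + 2) * ((n + Suc k) choose (2 * k + 3)) =
        (n + Suc k) * d * ((n + k) choose (2 * k + 1))" by (simp only: mult.assoc)
    then have "of_nat ((2 * k + 3) * (2 * k + 2) * ((n + Suc k) choose (2 * k + 3))) =
        (of_nat ((n + Suc k) * d * ((n + k) choose (2 * k + 1))) :: complex)" by (rule arg_cong)
    moreover have "(of_nat n ^ 2 - of_nat (Suc k) ^ 2 :: complex) = of_nat ((n + Suc k) * d)"
      unfolding d by (simp add: power2_eq_square algebra_simps)
    ultimately show ?thesis
      by (simp only: of_nat_mult) (simp add: eval_nat_numeral mult_ac)
  qed
  finally have "of_nat (2 * k + 3) * of_nat (2 * k + 2) * odd_binomial (Suc (Suc k)) (int n) =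
      of_nat (2 * k + 3) * of_nat (2 * k + 2) * of_nat ((n + Suc k) choose (2 * Suc k + 1))" .
  moreover have "of_nat (2 * k + 3) * of_nat (2 * k + 2) \<noteq> (0 :: complex)"
    unfolding of_nat_mult[symmetric] of_nat_eq_0_iff by simp
  ultimately show ?case by (metis mult_left_cancel)
qed

text \<open>The quotient is invariant under q -> 1/q, which is reflected in the oddness of its
  coefficients as a polynomial in \<open>u\<close>. The polynomial vanishes for
  \<open>1 \<le> u \<le> k\<close>, so the sum may start at 1.\<close>

lemma fps_X_power_divide_eq_gen_odd_binomial:
  assumes "m > 0"
  shows "fps_X ^ (Suc k * m) / (1 - fps_X ^ m) ^ (2 * Suc k) =
    gen {1..} (\<lambda>u. m * u) (\<lambda>u. odd_binomial (Suc k) (int u))"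
proof -
  have "fps_X ^ (Suc k * m) / (1 - fps_X ^ m) ^ (2 * Suc k) =
      gen {Suc k..} (\<lambda>u. m * u) (\<lambda>u. of_nat ((u - Suc k + (2 * k + 1)) choose (2 * k + 1)))"
    using fps_X_power_divide_eq_gen[OF assms, of "Suc k" "2 * k + 1"] by simp
  also have "\<dots> = gen {1..} (\<lambda>u. m * u) (\<lambda>u. odd_binomial (Suc k) (int u))"
  proof (rule fps_ext)
    fix N
    have "N div m - Suc k + (2 * k + 1) = N div m + k" if "Suc k \<le> N div m" using that by simp
    moreover have "(N div m + k) choose (2 * k + 1) = 0" if "\<not> Suc k \<le> N div m" using that by (simp add: binomial_eq_0)
    ultimately show "fps_nth (gen {Suc k..} (\<lambda>u. m * u) (\<lambda>u. of_nat ((u - Suc k + (2 * k + 1)) choose (2 * k + 1)))) N =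
        fps_nth (gen {1..} (\<lambda>u. m * u) (\<lambda>u. odd_binomial (Suc k) (int u))) N"
      unfolding gen_multiples_nth[OF assms] odd_binomial_eq by (auto simp: add.commute)
  qed
  finally show ?thesis .
qed

lemma sl3_weight_eq_gen:
  fixes m1 m2 :: nat
  assumes "m1 > 0" "m2 > 0"
  shows "sl3_weight (2 * Suc k) m1 m2 =
    gen ({1..} \<times> {1..} \<times> {1..}) (\<lambda>(u, v, w). m1 * u + (m2 * v + (m1 + m2) * w))
      (\<lambda>(u, v, w). odd_binomial (Suc k) (int u) * (odd_binomial (Suc k) (int v) * odd_binomial (Suc k) (int w)))"
proof -
  let ?g = "\<lambda>u. odd_binomial (Suc k) (int u)"
  define A :: "nat \<Rightarrow> complex fps" where "A m = fps_X ^ (Suc k * m)" for m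
  define B :: "nat \<Rightarrow> complex fps" where "B m = (1 - fps_X ^ m) ^ (2 * Suc k)" for m
  have B: "fps_nth (B m) 0 \<noteq> 0" if "m > 0" for m
    using that unfolding B_def fps_power_zeroth by simp
  have AB: "A m / B m = gen {1..} (\<lambda>u. m * u) ?g" if "m > 0" for m
    unfolding A_def B_def using that by (rule fps_X_power_divide_eq_gen_odd_binomial)
  have "sl3_weight (2 * Suc k) m1 m2 = (A m1 * A m2 * A (m1 + m2)) / (B m1 * B m2 * B (m1 + m2))"
  proof -
    \<comment> \<open>The numerator is shared out so that each of the three quotients has the
      balanced form with odd coefficients.\<close>
    have "2 * Suc k * (m1 + m2) = Suc k * m1 + Suc k * m2 + Suc k * (m1 + m2)" by (simp add: algebra_simps)
    then show ?thesis unfolding sl3_weight_def A_def B_def power_add[symmetric] by (simp only:)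
  qed
  also have "\<dots> = (A m1 / B m1) * ((A m2 / B m2) * (A (m1 + m2) / B (m1 + m2)))"
    using B[of m1] B[of m2] B[of "m1 + m2"] assms
    by (simp add: fps_divide_unit fps_inverse_mult mult_ac)
  also have "\<dots> = gen {1..} (\<lambda>u. m1 * u) ?g * (gen {1..} (\<lambda>u. m2 * u) ?g * gen {1..} (\<lambda>u. (m1 + m2) * u) ?g)"
    using assms by (simp add: AB)
  also have "\<dots> = gen {1..} (\<lambda>u. m1 * u) ?g *
      gen ({1..} \<times> {1..}) (\<lambda>(v, w). m2 * v + (m1 + m2) * w) (\<lambda>(v, w). ?g v * ?g w)"
  proof (subst gen_mult)
    fix N
    show "finite {i \<in> {1..}. m2 * i = N}" "finite {j \<in> {1..}. (m1 + m2) * j = N}"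
      by (rule finite_subset[of _ "{..N}"]; use assms in force)+
  qed simp
  also have "\<dots> = gen ({1..} \<times> {1..} \<times> {1..}) (\<lambda>(u, p). m1 * u + (case p of (v, w) \<Rightarrow> m2 * v + (m1 + m2) * w))
      (\<lambda>(u, p). ?g u * (case p of (v, w) \<Rightarrow> ?g v * ?g w))"
  proof (rule gen_mult)
    fix N
    show "finite {i \<in> {1..}. m1 * i = N}"
      by (rule finite_subset[of _ "{..N}"]) (use assms in force)+
    show "finite {p \<in> {1..} \<times> {1..}. (case p of (v, w) \<Rightarrow> m2 * v + (m1 + m2) * w) = N}"
    proof (rule finite_subset[of _ "{..N} \<times> {..N}"])
      have "v \<le> m2 * v + (m1 + m2) * w" "w \<le> m2 * v + (m1 + m2) * w" for v w
        using assms by (auto intro: trans_le_add1 trans_le_add2)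
      then show "{p \<in> {1..} \<times> {1..}. (case p of (v, w) \<Rightarrow> m2 * v + (m1 + m2) * w) = N} \<subseteq> {..N} \<times> {..N}"
        by auto
    qed simp
  qed
  finally show ?thesis by (simp add: case_prod_unfold)
qed

text \<open>Regroup \<open>m1 * u + m2 * v + (m1 + m2) * w\<close> as
  \<open>m1 * (u + w) + m2 * (v + w)\<close>. For given \<open>x = u + w\<close> and
  \<open>y = v + w\<close> the free variable is \<open>n = w\<close>, with
  \<open>0 < n < min x y\<close>, and summing over it gives the truncated convolution.\<close>

lemma has_sum_sl3_weight:
  "((\<lambda>(m1, m2). fps_const (c m1 m2) * sl3_weight (2 * Suc k) m1 m2) has_sum
    lam2 (\<lambda>a b x y. c (nat a) (nat b) * tconv (odd_binomial (Suc k)) (min x y) (max x y))) ({1..} \<times> {1..})"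
proof -
  let ?g = "odd_binomial (Suc k)"
  let ?I = "{1..} \<times> {1..} \<times> {1..} :: (nat \<times> nat \<times> nat) set"
  let ?A = "{1..} \<times> {1..} :: (nat \<times> nat) set"
  let ?w = "\<lambda>m (u, v, w). fst m * u + (snd m * v + (fst m + snd m) * w) :: nat"
  let ?u = "\<lambda>m (u, v, w). c (fst m) (snd m) * (?g (int u) * (?g (int v) * ?g (int w)))"
  let ?f = "\<lambda>(m, u, v, w). (int (fst m), int (snd m), int (u + w), int (v + w))"
  have fin: "finite {p \<in> Sigma ?A (\<lambda>_. ?I). (case p of (m, i) \<Rightarrow> ?w m i) = N}" for N
  proof (rule finite_subset)
    show "{p \<in> Sigma ?A (\<lambda>_. ?I). (case p of (m, i) \<Rightarrow> ?w m i) = N} \<subseteq>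
        ({..N} \<times> {..N}) \<times> ({..N} \<times> {..N} \<times> {..N})"
    proof
      fix p assume p: "p \<in> {p \<in> Sigma ?A (\<lambda>_. ?I). (case p of (m, i) \<Rightarrow> ?w m i) = N}"
      obtain a b u v w where eq: "p = ((a, b), (u, v, w))" by (metis prod.exhaust)
      with p have *: "1 \<le> a" "1 \<le> b" "1 \<le> u" "1 \<le> v" "1 \<le> w" "a * u + (b * v + (a * w + b * w)) = N"
        by (auto simp: algebra_simps)
      have "a \<le> a * u" "u \<le> a * u" "b \<le> b * v" "v \<le> b * v" "w \<le> a * w" using *(1-5) by auto
      with *(6) have "a \<le> N" "b \<le> N" "u \<le> N" "v \<le> N" "w \<le> N" by linarith+
      with eq show "p \<in> ({..N} \<times> {..N}) \<times> ({..N} \<times> {..N} \<times> {..N})" by simp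
    qed
  qed simp
  have "((\<lambda>m. gen ?I (?w m) (?u m)) has_sum
      gen (Sigma ?A (\<lambda>_. ?I)) (\<lambda>(m, i). ?w m i) (\<lambda>(m, i). ?u m i)) ?A"
    by (rule has_sum_gen) (rule fin)
  moreover have "gen (Sigma ?A (\<lambda>_. ?I)) (\<lambda>(m, i). ?w m i) (\<lambda>(m, i). ?u m i) =
      lam2 (\<lambda>a b x y. c (nat a) (nat b) * tconv ?g (min x y) (max x y))"
  proof -
    have "gen (Sigma ?A (\<lambda>_. ?I)) (\<lambda>(m, i). ?w m i) (\<lambda>(m, i). ?u m i) =
        gen {(a, b, x, y). 0 < a \<and> 0 < b \<and> 0 < x \<and> 0 < y} (\<lambda>(a, b, x, y). nat (a * x + b * y))
          (\<lambda>j. \<Sum>p\<in>{p \<in> Sigma ?A (\<lambda>_. ?I). ?f p = j}. case p of (m, i) \<Rightarrow> ?u m i)"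
    proof (rule gen_collapse[OF fin finite_lam2_fibre])
      fix p assume p: "p \<in> Sigma ?A (\<lambda>_. ?I)"
      obtain a b u v w where eq: "p = ((a, b), (u, v, w))" by (metis prod.exhaust)
      show "?f p \<in> {(a, b, x, y). 0 < a \<and> 0 < b \<and> 0 < x \<and> 0 < y}"
        using p unfolding eq by auto
      have "int a * int (u + w) + int b * int (v + w) = int (a * u + (b * v + (a + b) * w))"
        by (simp add: algebra_simps)
      then show "(case ?f p of (a, b, x, y) \<Rightarrow> nat (a * x + b * y)) = (case p of (m, i) \<Rightarrow> ?w m i)"
        unfolding eq by (simp del: of_nat_add of_nat_mult)
    qed
    also have "\<dots> = lam2 (\<lambda>a b x y. c (nat a) (nat b) * tconv ?g (min x y) (max x y))"
      unfolding lam2_def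
    proof (rule gen_cong)
      fix j :: "int \<times> int \<times> int \<times> int"
      assume "j \<in> {(a, b, x, y). 0 < a \<and> 0 < b \<and> 0 < x \<and> 0 < y}"
      then obtain a b x y where j: "j = (a, b, x, y)" "0 < a" "0 < b" "0 < x" "0 < y" by auto
      have "(\<Sum>p\<in>{p \<in> Sigma ?A (\<lambda>_. ?I). ?f p = j}. case p of (m, i) \<Rightarrow> ?u m i) =
          (\<Sum>n\<in>{0<..<min x y}. c (nat a) (nat b) * (?g (x - n) * (?g (y - n) * ?g n)))"
        by (rule sum.reindex_bij_witness[of _ "\<lambda>n. ((nat a, nat b), (nat (x - n), nat (y - n), nat n))"
              "\<lambda>(m, u, v, w). int w"]) (use j in auto)
      also have "\<dots> = c (nat a) (nat b) * tconv ?g (min x y) (max x y)"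
        unfolding tconv_def sum_distrib_left
        by (intro sum.cong) (auto simp: min_def max_def mult_ac)
      finally show "(\<Sum>p\<in>{p \<in> Sigma ?A (\<lambda>_. ?I). ?f p = j}. case p of (m, i) \<Rightarrow> ?u m i) =
          (case j of (a, b, x, y) \<Rightarrow> c (nat a) (nat b) * tconv ?g (min x y) (max x y))"
        by (simp add: j)
    qed simp
    finally show ?thesis .
  qed
  moreover have "gen ?I (?w m) (?u m) = (case m of (m1, m2) \<Rightarrow> fps_const (c m1 m2) * sl3_weight (2 * Suc k) m1 m2)"
    if "m \<in> ?A" for m
  proof -
    obtain m1 m2 where m: "m = (m1, m2)" by (cases m)
    with that have pos: "m1 > 0" "m2 > 0" by auto
    have "gen ?I (?w m) (\<lambda>i. 0 + c m1 m2 * (case i of (u, v, w) \<Rightarrow> ?g (int u) * (?g (int v) * ?g (int w)))) =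
        fps_const (c m1 m2) * sl3_weight (2 * Suc k) m1 m2"
      unfolding gen_add gen_zero sl3_weight_eq_gen[OF pos] by (simp add: m)
    then show ?thesis by (simp add: m case_prod_unfold)
  qed
  ultimately show ?thesis
    using has_sum_cong by (metis (no_types, lifting))
qed

text \<open>The scalar \<open>d\<close> is 1 for the plain sum and 1/2 for the normalisation by the
  dimension. The existence of a sum in the ring yields summability and membership at once.\<close>

lemma sl3_sum:
  assumes "even s" "s > 0"
  shows "\<exists>F\<in>quasi_modular. ((\<lambda>(m1, m2). fps_const ((d * of_nat (m1 * m2 * (m1 + m2))) ^ s) *
    sl3_weight (2 * Suc k) m1 m2) has_sum F) ({1..} \<times> {1..})"
proof (rule bexI)
  let ?g = "odd_binomial (Suc k)"
  let ?c = "\<lambda>m1 m2. (d * of_nat (m1 * m2 * (m1 + m2))) ^ s"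
  show "((\<lambda>(m1, m2). fps_const (?c m1 m2) * sl3_weight (2 * Suc k) m1 m2) has_sum
      lam2 (\<lambda>a b x y. ?c (nat a) (nat b) * tconv ?g (min x y) (max x y))) ({1..} \<times> {1..})"
    by (rule has_sum_sl3_weight)
  have "lam2 (\<lambda>a b x y. ?c (nat a) (nat b) * tconv ?g (min x y) (max x y)) =
      lam2 (\<lambda>a b x y. d ^ s * (of_int (a * b * (a + b)) ^ s * tconv ?g (min x y) (max x y)))"
  proof (rule lam2_cong)
    fix a b x y :: int assume "0 < a" "0 < b"
    then have "(of_nat (nat a * nat b * (nat a + nat b)) :: complex) = of_int (a * b * (a + b))"
      by simp
    then show "?c (nat a) (nat b) * tconv ?g (min x y) (max x y) =
        d ^ s * (of_int (a * b * (a + b)) ^ s * tconv ?g (min x y) (max x y))"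
      by (simp only: power_mult_distrib mult.assoc)
  qed
  also have "\<dots> \<in> quasi_modular"
    unfolding lam2_scale
    by (intro quasi_modular_scale quasi_modular_lam2_tconv odd_binomial_pspan assms)
  finally show "lam2 (\<lambda>a b x y. ?c (nat a) (nat b) * tconv ?g (min x y) (max x y)) \<in> quasi_modular" .
qed

theorem theorem3p13:
  fixes k :: nat
  assumes "k \<ge> 1"
  shows "(\<forall>a::nat. even a \<longrightarrow>
            sl3_term (2 * k + a) (2 * k) summable_on ({1..} \<times> {1..}) \<and>
            (\<Sum>\<^sub>\<infinity>m\<in>{1..} \<times> {1..}. sl3_term (2 * k + a) (2 * k) m) \<in> quasi_modular) \<and>
         sl3_qzeta (2 * k + 2) (2 * k) \<in> quasi_modular"
proof -
  obtain k' where k: "k = Suc k'" using assms by (cases k) auto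
  have "sl3_term (2 * k + a) (2 * k) summable_on ({1..} \<times> {1..}) \<and>
      (\<Sum>\<^sub>\<infinity>m\<in>{1..} \<times> {1..}. sl3_term (2 * k + a) (2 * k) m) \<in> quasi_modular" if "even a" for a
  proof -
    have "even (2 * k + a)" "2 * k + a > 0" using that k by auto
    from sl3_sum[OF this, of 1 k'] obtain F where F: "F \<in> quasi_modular"
      "((\<lambda>(m1, m2). fps_const ((1 * of_nat (m1 * m2 * (m1 + m2))) ^ (2 * k + a)) *
         sl3_weight (2 * Suc k') m1 m2) has_sum F) ({1..} \<times> {1..})"
      by blast
    moreover have "(\<lambda>(m1, m2). fps_const ((1 * of_nat (m1 * m2 * (m1 + m2))) ^ (2 * k + a)) *
         sl3_weight (2 * Suc k') m1 m2) = sl3_term (2 * k + a) (2 * k)"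
      unfolding sl3_term_def k fps_const_power[symmetric] fps_of_nat mult_1 ..
    ultimately have "(sl3_term (2 * k + a) (2 * k) has_sum F) ({1..} \<times> {1..})" by simp
    with F(1) show ?thesis using infsumI summable_on_def by blast
  qed
  moreover have "sl3_qzeta (2 * k + 2) (2 * k) \<in> quasi_modular"
  proof -
    have "even (2 * k + 2)" "2 * k + 2 > 0" by auto
    from sl3_sum[OF this, of "1 / 2" k'] obtain F where F: "F \<in> quasi_modular"
      "((\<lambda>(m1, m2). fps_const ((1 / 2 * of_nat (m1 * m2 * (m1 + m2))) ^ (2 * k + 2)) *
         sl3_weight (2 * Suc k') m1 m2) has_sum F) ({1..} \<times> {1..})"
      by blast
    have "sl3_dim m1 m2 = 1 / 2 * of_nat (m1 * m2 * (m1 + m2))" for m1 m2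
      by (simp add: sl3_dim_def)
    then have "sl3_qzeta (2 * k + 2) (2 * k) = F"
      unfolding sl3_qzeta_def k using infsumI[OF F(2)] by (simp only: k)
    with F(1) show ?thesis by simp
  qed
  ultimately show ?thesis by blast
qed

end
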